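(* Let $A$ and $B$ be Morita equivalent finite-dimensional algebras over a field $F$. Then there is an $F$-linear isomorphism $A/K(A) \to B/K(B)$ which, for every integer $n \ge 1$, induces an $F$-linear isomorphism $A/KR^n(A) \to B/KR^n(B)$ (that is, the two isomorphisms commute with the canonical epimorphisms $A/K(A) \to A/KR^n(A)$ and $B/K(B) \to B/KR^n(B)$).
   Context: Algebras are associative and unital. For a finite-dimensional $F$-algebra $A$, $K(A)$ denotes the commutator subspace, i.e. the $F$-subspace of $A$ spanned by all $xy - yx$ with $x, y \in A$; $\operatorname{Rad}^n(A)$ is the $n$th power of the Jacobson radical of $A$; and $KR^n(A) := K(A) + \operatorname{Rad}^n(A)$. Morita equivalence of $F$-algebras means $F$-linear equivalence of their module categories. *)

theory Defs
  imports "HOL.Hull" "HOL-Algebra.Module" "HOL-Algebra.Ideal_Product" "HOL-Library.Equipollence"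
begin

section \<open>Algebras over a field\<close>

text \<open>
  The library locale \<open>algebra\<close> is restricted to commutative algebras; here only the ground ring
  is commutative. The zero algebra is allowed.
\<close>

locale assoc_algebra = field F + module F A + A: ring A
  for F :: "('k, 'c) ring_scheme" and A :: "('k, 'a, 'd) module_scheme" +
  assumes smult_mult_left:
      "\<lbrakk>c \<in> carrier F; x \<in> carrier A; y \<in> carrier A\<rbrakk> \<Longrightarrow>
       (c \<odot>\<^bsub>A\<^esub> x) \<otimes>\<^bsub>A\<^esub> y = c \<odot>\<^bsub>A\<^esub> (x \<otimes>\<^bsub>A\<^esub> y)"
    and smult_mult_right:
      "\<lbrakk>c \<in> carrier F; x \<in> carrier A; y \<in> carrier A\<rbrakk> \<Longrightarrow>
       x \<otimes>\<^bsub>A\<^esub> (c \<odot>\<^bsub>A\<^esub> y) = c \<odot>\<^bsub>A\<^esub> (x \<otimes>\<^bsub>A\<^esub> y)"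

definition lin_span ::
    "('k, 'c) ring_scheme \<Rightarrow> ('k, 'v, 'd) module_scheme \<Rightarrow> 'v set \<Rightarrow> 'v set" where
  "lin_span F V S = (\<lambda>W. submodule W F V) hull S"

definition finite_dimensional ::
    "('k, 'c) ring_scheme \<Rightarrow> ('k, 'v, 'd) module_scheme \<Rightarrow> bool" where
  "finite_dimensional F V \<longleftrightarrow>
     (\<exists>S. finite S \<and> S \<subseteq> carrier V \<and> lin_span F V S = carrier V)"

definition commutator_space ::
    "('k, 'c) ring_scheme \<Rightarrow> ('k, 'a, 'd) module_scheme \<Rightarrow> 'a set" where
  "commutator_space F A =
     lin_span F A {x \<otimes>\<^bsub>A\<^esub> y \<ominus>\<^bsub>A\<^esub> y \<otimes>\<^bsub>A\<^esub> x | x y. x \<in> carrier A \<and> y \<in> carrier A}"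

definition left_ideal :: "'a set \<Rightarrow> ('a, 'd) ring_scheme \<Rightarrow> bool" where
  "left_ideal I A \<longleftrightarrow>
     additive_subgroup I A \<and> (\<forall>a\<in>carrier A. \<forall>x\<in>I. a \<otimes>\<^bsub>A\<^esub> x \<in> I)"

definition maximal_left_ideal :: "'a set \<Rightarrow> ('a, 'd) ring_scheme \<Rightarrow> bool" where
  "maximal_left_ideal I A \<longleftrightarrow>
     left_ideal I A \<and> I \<noteq> carrier A \<and>
     (\<forall>J. left_ideal J A \<and> I \<subseteq> J \<longrightarrow> J = I \<or> J = carrier A)"

definition jacobson_radical :: "('a, 'd) ring_scheme \<Rightarrow> 'a set" where
  "jacobson_radical A = carrier A \<inter> \<Inter>{I. maximal_left_ideal I A}"

text \<open>
  Powers are taken in the library's monoid of two-sided ideals, whose unit is the whole ring, so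
  the first power is the radical itself.
\<close>

definition rad_power :: "('a, 'd) ring_scheme \<Rightarrow> nat \<Rightarrow> 'a set" where
  "rad_power A n = jacobson_radical A [^]\<^bsub>ideals_set A\<^esub> n"

definition KR ::
    "('k, 'c) ring_scheme \<Rightarrow> ('k, 'a, 'd) module_scheme \<Rightarrow> nat \<Rightarrow> 'a set" where
  "KR F A n = commutator_space F A <+>\<^bsub>A\<^esub> rad_power A n"


section \<open>Linear maps and quotient spaces\<close>

definition lin_maps ::
    "('k, 'c) ring_scheme \<Rightarrow> ('k, 'v, 'd) module_scheme \<Rightarrow> ('k, 'w, 'e) module_scheme
      \<Rightarrow> ('v \<Rightarrow> 'w) set" where
  "lin_maps R V W =
     {f \<in> carrier V \<rightarrow> carrier W.
        (\<forall>x\<in>carrier V. \<forall>y\<in>carrier V. f (x \<oplus>\<^bsub>V\<^esub> y) = f x \<oplus>\<^bsub>W\<^esub> f y) \<and>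
        (\<forall>c\<in>carrier R. \<forall>x\<in>carrier V. f (c \<odot>\<^bsub>V\<^esub> x) = c \<odot>\<^bsub>W\<^esub> f x)}"

definition lin_isos ::
    "('k, 'c) ring_scheme \<Rightarrow> ('k, 'v, 'd) module_scheme \<Rightarrow> ('k, 'w, 'e) module_scheme
      \<Rightarrow> ('v \<Rightarrow> 'w) set" where
  "lin_isos R V W = {f \<in> lin_maps R V W. bij_betw f (carrier V) (carrier W)}"

text \<open>
  The quotient of \<open>V\<close> by a subspace \<open>W\<close>, with cosets as elements. The fields \<open>mult\<close> and \<open>one\<close>
  come from the record type and play no role for vector spaces. The summand \<open>W\<close> in the scalar
  multiple \<open>W + c X\<close> of a coset \<open>X\<close> matters for \<open>c = 0\<close>, where \<open>c X\<close> is not a coset.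
\<close>

definition quotient_space ::
    "('k, 'v, 'd) module_scheme \<Rightarrow> 'v set \<Rightarrow> ('k, 'v set) module" where
  "quotient_space V W =
     \<lparr>carrier = a_rcosets\<^bsub>V\<^esub> W, mult = undefined, one = undefined,
      zero = W, add = set_add V,
      smult = (\<lambda>c X. W <+>\<^bsub>V\<^esub> (\<lambda>x. c \<odot>\<^bsub>V\<^esub> x) ` X)\<rparr>"

text \<open>
  For \<open>U \<subseteq> W\<close>, the canonical epimorphism from \<open>V/U\<close> to \<open>V/W\<close> sends \<open>U + x\<close> to
  \<open>W + (U + x) = W + x\<close>.
\<close>

definition canonical_epi ::
    "('k, 'v, 'd) module_scheme \<Rightarrow> 'v set \<Rightarrow> 'v set \<Rightarrow> 'v set" where
  "canonical_epi V W X = W <+>\<^bsub>V\<^esub> X"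


section \<open>Linear categories\<close>

text \<open>
  The hom-space \<open>hom_space C X Y\<close> is a vector space whose carrier is the set of morphisms from
  \<open>X\<close> to \<open>Y\<close>; \<open>compose_arr C X Y Z g f\<close> is \<open>g\<close> after \<open>f\<close> for \<open>f : X \<rightarrow> Y\<close> and \<open>g : Y \<rightarrow> Z\<close>.
\<close>

record ('k, 'o, 'm) linear_category =
  objects :: "'o set"
  hom_space :: "'o \<Rightarrow> 'o \<Rightarrow> ('k, 'm) module"
  id_arr :: "'o \<Rightarrow> 'm"
  compose_arr :: "'o \<Rightarrow> 'o \<Rightarrow> 'o \<Rightarrow> 'm \<Rightarrow> 'm \<Rightarrow> 'm"

abbreviation arrows ::
    "('k, 'o, 'm) linear_category \<Rightarrow> 'o \<Rightarrow> 'o \<Rightarrow> 'm set" where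
  "arrows C X Y \<equiv> carrier (hom_space C X Y)"

record ('o, 'm, 'p, 'q) category_map =
  on_objects :: "'o \<Rightarrow> 'p"
  on_arrows :: "'o \<Rightarrow> 'o \<Rightarrow> 'm \<Rightarrow> 'q"

definition linear_functor ::
    "('k, 'c) ring_scheme \<Rightarrow> ('k, 'o, 'm) linear_category \<Rightarrow> ('k, 'p, 'q) linear_category
      \<Rightarrow> ('o, 'm, 'p, 'q) category_map \<Rightarrow> bool" where
  "linear_functor F C D T \<longleftrightarrow>
     on_objects T \<in> objects C \<rightarrow> objects D \<and>
     (\<forall>X\<in>objects C. \<forall>Y\<in>objects C.
        on_arrows T X Y \<in>
          lin_maps F (hom_space C X Y) (hom_space D (on_objects T X) (on_objects T Y))) \<and>
     (\<forall>X\<in>objects C. on_arrows T X X (id_arr C X) = id_arr D (on_objects T X)) \<and>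
     (\<forall>X\<in>objects C. \<forall>Y\<in>objects C. \<forall>Z\<in>objects C.
        \<forall>f\<in>arrows C X Y. \<forall>g\<in>arrows C Y Z.
          on_arrows T X Z (compose_arr C X Y Z g f) =
          compose_arr D (on_objects T X) (on_objects T Y) (on_objects T Z)
            (on_arrows T Y Z g) (on_arrows T X Y f))"

definition identity_functor :: "('o, 'm, 'o, 'm) category_map" where
  "identity_functor = \<lparr>on_objects = (\<lambda>X. X), on_arrows = (\<lambda>X Y f. f)\<rparr>"

definition compose_functor ::
    "('p, 'q, 'r, 's) category_map \<Rightarrow> ('o, 'm, 'p, 'q) category_map
      \<Rightarrow> ('o, 'm, 'r, 's) category_map" where
  "compose_functor S T =
     \<lparr>on_objects = (\<lambda>X. on_objects S (on_objects T X)),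
      on_arrows = (\<lambda>X Y f. on_arrows S (on_objects T X) (on_objects T Y) (on_arrows T X Y f))\<rparr>"

definition iso_arrows ::
    "('k, 'o, 'm) linear_category \<Rightarrow> 'o \<Rightarrow> 'o \<Rightarrow> 'm set" where
  "iso_arrows C X Y =
     {f \<in> arrows C X Y. \<exists>g\<in>arrows C Y X.
        compose_arr C X Y X g f = id_arr C X \<and> compose_arr C Y X Y f g = id_arr C Y}"

definition naturally_isomorphic ::
    "('k, 'o, 'm) linear_category \<Rightarrow> ('k, 'p, 'q) linear_category
      \<Rightarrow> ('o, 'm, 'p, 'q) category_map \<Rightarrow> ('o, 'm, 'p, 'q) category_map \<Rightarrow> bool" where
  "naturally_isomorphic C D S T \<longleftrightarrow>
     (\<exists>\<eta>. (\<forall>X\<in>objects C. \<eta> X \<in> iso_arrows D (on_objects S X) (on_objects T X)) \<and>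
          (\<forall>X\<in>objects C. \<forall>Y\<in>objects C. \<forall>f\<in>arrows C X Y.
             compose_arr D (on_objects S X) (on_objects S Y) (on_objects T Y)
               (\<eta> Y) (on_arrows S X Y f) =
             compose_arr D (on_objects S X) (on_objects T X) (on_objects T Y)
               (on_arrows T X Y f) (\<eta> X)))"

definition linearly_equivalent ::
    "('k, 'c) ring_scheme \<Rightarrow> ('k, 'o, 'm) linear_category \<Rightarrow> ('k, 'p, 'q) linear_category
      \<Rightarrow> bool" where
  "linearly_equivalent F C D \<longleftrightarrow>
     (\<exists>T S. linear_functor F C D T \<and> linear_functor F D C S \<and>
            naturally_isomorphic C C (compose_functor S T) identity_functor \<and>
            naturally_isomorphic D D (compose_functor T S) identity_functor)"


section \<open>Module categories and Morita equivalence\<close>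

text \<open>
  The library locale \<open>module\<close> requires a commutative ring of scalars; this is the same notion for
  left modules over an arbitrary ring.
\<close>

locale left_module = ring A + M: abelian_group M
  for A :: "('a, 'd) ring_scheme" and M :: "('a, 'm, 'e) module_scheme" +
  assumes act_closed:
      "\<lbrakk>a \<in> carrier A; x \<in> carrier M\<rbrakk> \<Longrightarrow> a \<odot>\<^bsub>M\<^esub> x \<in> carrier M"
    and act_l_distr:
      "\<lbrakk>a \<in> carrier A; b \<in> carrier A; x \<in> carrier M\<rbrakk> \<Longrightarrow>
       (a \<oplus>\<^bsub>A\<^esub> b) \<odot>\<^bsub>M\<^esub> x = a \<odot>\<^bsub>M\<^esub> x \<oplus>\<^bsub>M\<^esub> b \<odot>\<^bsub>M\<^esub> x"
    and act_r_distr: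
      "\<lbrakk>a \<in> carrier A; x \<in> carrier M; y \<in> carrier M\<rbrakk> \<Longrightarrow>
       a \<odot>\<^bsub>M\<^esub> (x \<oplus>\<^bsub>M\<^esub> y) = a \<odot>\<^bsub>M\<^esub> x \<oplus>\<^bsub>M\<^esub> a \<odot>\<^bsub>M\<^esub> y"
    and act_assoc:
      "\<lbrakk>a \<in> carrier A; b \<in> carrier A; x \<in> carrier M\<rbrakk> \<Longrightarrow>
       (a \<otimes>\<^bsub>A\<^esub> b) \<odot>\<^bsub>M\<^esub> x = a \<odot>\<^bsub>M\<^esub> (b \<odot>\<^bsub>M\<^esub> x)"
    and act_one:
      "x \<in> carrier M \<Longrightarrow> \<one>\<^bsub>A\<^esub> \<odot>\<^bsub>M\<^esub> x = x"

text \<open>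
  Morphisms are extensional functions, so that two of them are equal iff they agree on the
  carrier of their domain. The ground field acts on morphisms, as on modules, through
  \<open>c \<mapsto> c \<cdot> 1\<close>; \<open>mult\<close> and \<open>one\<close> are again irrelevant record fields.
\<close>

definition module_hom_space ::
    "('k, 'a, 'd) module_scheme \<Rightarrow> ('a, 'u) module \<Rightarrow> ('a, 'u) module
      \<Rightarrow> ('k, 'u \<Rightarrow> 'u) module" where
  "module_hom_space A M N =
     \<lparr>carrier = lin_maps A M N \<inter> extensional (carrier M),
      mult = undefined, one = undefined,
      zero = (\<lambda>x\<in>carrier M. \<zero>\<^bsub>N\<^esub>),
      add = (\<lambda>f g. \<lambda>x\<in>carrier M. f x \<oplus>\<^bsub>N\<^esub> g x),
      smult = (\<lambda>c f. \<lambda>x\<in>carrier M. (c \<odot>\<^bsub>A\<^esub> \<one>\<^bsub>A\<^esub>) \<odot>\<^bsub>N\<^esub> f x)\<rparr>"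

text \<open>
  The category of all left \<open>A\<close>-modules with underlying set contained in the type \<open>'u\<close>, which
  plays the role of a universe.
\<close>

definition module_category ::
    "('k, 'a, 'd) module_scheme \<Rightarrow> ('k, ('a, 'u) module, 'u \<Rightarrow> 'u) linear_category" where
  "module_category A =
     \<lparr>objects = {M. left_module A M},
      hom_space = module_hom_space A,
      id_arr = (\<lambda>M. \<lambda>x\<in>carrier M. x),
      compose_arr = (\<lambda>L M N g f. compose (carrier L) g f)\<rparr>"

definition morita_equivalent ::
    "'u itself \<Rightarrow> ('k, 'c) ring_scheme \<Rightarrow> ('k, 'a, 'd) module_scheme
      \<Rightarrow> ('k, 'b, 'e) module_scheme \<Rightarrow> bool" where
  "morita_equivalent (_ :: 'u itself) F A B \<longleftrightarrow>
     linearly_equivalent F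
       (module_category A :: ('k, ('a, 'u) module, 'u \<Rightarrow> 'u) linear_category)
       (module_category B :: ('k, ('b, 'u) module, 'u \<Rightarrow> 'u) linear_category)"

text \<open>
  A universe must be infinite and have room for the regular module. It then contains
  a copy of every module whose cardinality does not exceed that of \<open>'u\<close>, in particular of every
  finitely generated one. In too small a type there may be no nonzero modules at all, and any
  two algebras would count as equivalent.
\<close>

definition module_universe :: "'u itself \<Rightarrow> ('a, 'd) ring_scheme \<Rightarrow> bool" where
  "module_universe (_ :: 'u itself) A \<longleftrightarrow>
     infinite (UNIV :: 'u set) \<and> carrier A \<lesssim> (UNIV :: 'u set)"

end

theory Submission
  imports Defs "HOL-Algebra.RingHom"
begin

text \<open>
  Let \<open>T\<close> be an equivalence of module categories with inverse \<open>S\<close>. Since the regular module of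
  \<open>A\<close> is a generator, so is \<open>P = T(A)\<close>, and the trace ideal of \<open>P\<close> in \<open>B\<close> is all of \<open>B\<close>: the
  identity of \<open>B\<close> is a finite sum of endomorphisms factoring through \<open>P\<close>. By symmetry the
  identity of \<open>A\<close> is such a sum through \<open>S(B)\<close>; applying \<open>T\<close>, the identity of \<open>P\<close> is a sum
  \<open>\<Sum> s\<^sub>j r\<^sub>j\<close> through \<open>B\<close>. Now \<open>End P\<close> is \<open>A\<close> and \<open>End B\<close> is \<open>B\<close>, and \<open>x \<mapsto> \<Sum> r\<^sub>j x s\<^sub>j\<close> is a
  linear map \<open>A \<rightarrow> B\<close>. It sends \<open>ab\<close> to \<open>ba\<close> modulo \<open>K(B)\<close> for \<open>a : P \<rightarrow> B\<close> and \<open>b : B \<rightarrow> P\<close>, so it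
  maps \<open>K(A)\<close> into \<open>K(B)\<close> and is inverse, modulo commutators, to the analogous map \<open>B \<rightarrow> A\<close>. By
  Jacobson's lemma on \<open>1 - xy\<close> and \<open>1 - yx\<close> both maps respect the powers of the radical. Neither
  projectivity nor finite generation of \<open>P\<close> has to be characterised categorically.
\<close>

subsection \<open>Linear maps and submodules\<close>

text \<open>If the identity of \<open>X\<close> is a sum of composites through \<open>Y\<close>,
  then \<open>X\<close> is a direct summand of a finite power of \<open>Y\<close>, and an
  endomorphism \<open>x\<close> of \<open>X\<close> becomes a matrix over End \<open>Y\<close> with
  entries \<open>r\<^sub>i x s\<^sub>j\<close>. The map of the overview sums the diagonal: it is the
  Hattori-Stallings trace, which is why it is cyclic only modulo commutators. Lists of pairs of
  arrows stand in for the direct sums.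

  Jacobson's lemma settles \<open>r j s\<close> for a single radical element \<open>j\<close>. For a
  product of radical elements the sum representing the identity has to be inserted between the
  factors, which turns them into a product of endomorphisms of \<open>Y\<close>.

  The other obstacle is the universe: the elements of \<open>A\<close> need not have the type in
  which modules live, so \<open>A\<close> itself need not be an object. The regular module and the
  quotient by the trace ideal are rebuilt on the image of an injection of \<open>A\<close>, and
  \<open>A\<close> enters through its isomorphism with an endomorphism algebra. The comparison thus
  becomes a chain of algebras, linked by \<open>KR_equivalent\<close>.\<close>

lemma (in abelian_group) minus_add_cancel:
  "x \<in> carrier G \<Longrightarrow> y \<in> carrier G \<Longrightarrow> (x \<ominus> y) \<oplus> y = x"
  by (simp add: minus_eq a_assoc l_neg)

lemma lin_mapsD:
  assumes "f \<in> lin_maps R V W"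
  shows lin_maps_closed: "\<And>x. x \<in> carrier V \<Longrightarrow> f x \<in> carrier W"
    and lin_maps_add: "\<And>x y. x \<in> carrier V \<Longrightarrow> y \<in> carrier V \<Longrightarrow> f (x \<oplus>\<^bsub>V\<^esub> y) = f x \<oplus>\<^bsub>W\<^esub> f y"
    and lin_maps_smult: "\<And>c x. c \<in> carrier R \<Longrightarrow> x \<in> carrier V \<Longrightarrow> f (c \<odot>\<^bsub>V\<^esub> x) = c \<odot>\<^bsub>W\<^esub> f x"
  using assms unfolding lin_maps_def by auto

lemma lin_mapsI:
  assumes "\<And>x. x \<in> carrier V \<Longrightarrow> f x \<in> carrier W"
    and "\<And>x y. x \<in> carrier V \<Longrightarrow> y \<in> carrier V \<Longrightarrow> f (x \<oplus>\<^bsub>V\<^esub> y) = f x \<oplus>\<^bsub>W\<^esub> f y"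
    and "\<And>c x. c \<in> carrier R \<Longrightarrow> x \<in> carrier V \<Longrightarrow> f (c \<odot>\<^bsub>V\<^esub> x) = c \<odot>\<^bsub>W\<^esub> f x"
  shows "f \<in> lin_maps R V W"
  using assms unfolding lin_maps_def by auto

lemma lin_maps_group:
  assumes "abelian_group V" "abelian_group W" "f \<in> lin_maps R V W"
  shows lin_maps_zero: "f \<zero>\<^bsub>V\<^esub> = \<zero>\<^bsub>W\<^esub>"
    and lin_maps_a_inv: "\<And>x. x \<in> carrier V \<Longrightarrow> f (\<ominus>\<^bsub>V\<^esub> x) = \<ominus>\<^bsub>W\<^esub> f x"
    and lin_maps_minus:
      "\<And>x y. x \<in> carrier V \<Longrightarrow> y \<in> carrier V \<Longrightarrow> f (x \<ominus>\<^bsub>V\<^esub> y) = f x \<ominus>\<^bsub>W\<^esub> f y"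
proof -
  interpret V: abelian_group V by fact
  interpret W: abelian_group W by fact
  note [simp] = lin_mapsD[OF assms(3)]
  have "f \<zero>\<^bsub>V\<^esub> \<oplus>\<^bsub>W\<^esub> f \<zero>\<^bsub>V\<^esub> = f \<zero>\<^bsub>V\<^esub>"
    using lin_maps_add[OF assms(3), of "\<zero>\<^bsub>V\<^esub>" "\<zero>\<^bsub>V\<^esub>"] by simp
  then show z: "f \<zero>\<^bsub>V\<^esub> = \<zero>\<^bsub>W\<^esub>"
    by (simp add: W.add.l_cancel_one)
  show i: "f (\<ominus>\<^bsub>V\<^esub> x) = \<ominus>\<^bsub>W\<^esub> f x" if x: "x \<in> carrier V" for x
  proof (rule W.minus_equality[symmetric])
    show "f (\<ominus>\<^bsub>V\<^esub> x) \<oplus>\<^bsub>W\<^esub> f x = \<zero>\<^bsub>W\<^esub>"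
      using x lin_maps_add[OF assms(3), of "\<ominus>\<^bsub>V\<^esub> x" x] by (simp add: z V.l_neg)
  qed (use x in auto)
  show "f (x \<ominus>\<^bsub>V\<^esub> y) = f x \<ominus>\<^bsub>W\<^esub> f y" if "x \<in> carrier V" "y \<in> carrier V" for x y
    using that by (simp add: V.minus_eq W.minus_eq i)
qed

lemma lin_maps_compose:
  assumes "f \<in> lin_maps R U V" "g \<in> lin_maps R V W"
  shows "(\<lambda>x. g (f x)) \<in> lin_maps R U W"
  using assms by (auto simp: lin_maps_def Pi_iff)

context module
begin

lemma submodule_abelian_subgroup:
  assumes "submodule W R M"
  shows "abelian_subgroup W M"
  using assms by (simp add: abelian_subgroupI3 additive_subgroupI is_abelian_group submodule.axioms(1) M.abelian_group_axioms)

lemma submodule_zero_closed: "submodule W R M \<Longrightarrow> \<zero>\<^bsub>M\<^esub> \<in> W"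
  by (metis submodule_abelian_subgroup abelian_subgroup.axioms(1) additive_subgroup.zero_closed)

lemma lin_span_submodule:
  assumes "S \<subseteq> carrier M"
  shows "submodule (lin_span R M S) R M"
proof -
  have mem: "x \<in> lin_span R M S \<longleftrightarrow> (\<forall>W. submodule W R M \<and> S \<subseteq> W \<longrightarrow> x \<in> W)" for x
    unfolding lin_span_def hull_def by auto
  show ?thesis
    by (rule submoduleI)
      (use carrier_is_submodule assms in \<open>auto simp: mem submoduleE submodule_zero_closed\<close>)
qed

lemma lin_span_minimal: "submodule W R M \<Longrightarrow> S \<subseteq> W \<Longrightarrow> lin_span R M S \<subseteq> W"
  unfolding lin_span_def by (rule hull_minimal)

lemma submodule_set_add:
  assumes "submodule U R M" "submodule W R M"
  shows "submodule (U <+>\<^bsub>M\<^esub> W) R M"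
proof (rule submoduleI)
  note U = submoduleE[OF assms(1)] and W = submoduleE[OF assms(2)]
  have mem: "x \<in> U <+>\<^bsub>M\<^esub> W \<longleftrightarrow> (\<exists>u\<in>U. \<exists>w\<in>W. x = u \<oplus>\<^bsub>M\<^esub> w)" for x
    by (auto simp: set_add_def')
  show "U <+>\<^bsub>M\<^esub> W \<subseteq> carrier M"
    using U(1) W(1) by (auto simp: mem subset_iff)
  show "\<zero>\<^bsub>M\<^esub> \<in> U <+>\<^bsub>M\<^esub> W"
    unfolding mem using submodule_zero_closed[OF assms(1)] submodule_zero_closed[OF assms(2)] by force
  show "\<ominus>\<^bsub>M\<^esub> x \<in> U <+>\<^bsub>M\<^esub> W" if x: "x \<in> U <+>\<^bsub>M\<^esub> W" for x
  proof -
    obtain u w where "u \<in> U" "w \<in> W" "x = u \<oplus>\<^bsub>M\<^esub> w" using x unfolding mem by blast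
    then have "\<ominus>\<^bsub>M\<^esub> x = \<ominus>\<^bsub>M\<^esub> u \<oplus>\<^bsub>M\<^esub> \<ominus>\<^bsub>M\<^esub> w" using U(1) W(1) by (simp add: M.minus_add subset_iff)
    then show ?thesis using U(3) W(3) \<open>u \<in> U\<close> \<open>w \<in> W\<close> unfolding mem by blast
  qed
  show "x \<oplus>\<^bsub>M\<^esub> y \<in> U <+>\<^bsub>M\<^esub> W" if xy: "x \<in> U <+>\<^bsub>M\<^esub> W" "y \<in> U <+>\<^bsub>M\<^esub> W" for x y
  proof -
    obtain u w u' w' where h: "u \<in> U" "w \<in> W" "x = u \<oplus>\<^bsub>M\<^esub> w" "u' \<in> U" "w' \<in> W" "y = u' \<oplus>\<^bsub>M\<^esub> w'"
      using xy unfolding mem by blast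
    then have "u \<in> carrier M" "w \<in> carrier M" "u' \<in> carrier M" "w' \<in> carrier M"
      using U(1) W(1) by auto
    then have "x \<oplus>\<^bsub>M\<^esub> y = (u \<oplus>\<^bsub>M\<^esub> u') \<oplus>\<^bsub>M\<^esub> (w \<oplus>\<^bsub>M\<^esub> w')"
      using h by (simp add: M.a_ac)
    then show ?thesis using U(5) W(5) h unfolding mem by blast
  qed
  show "c \<odot>\<^bsub>M\<^esub> x \<in> U <+>\<^bsub>M\<^esub> W" if x: "c \<in> carrier R" "x \<in> U <+>\<^bsub>M\<^esub> W" for c x
  proof -
    obtain u w where "u \<in> U" "w \<in> W" "x = u \<oplus>\<^bsub>M\<^esub> w" using x unfolding mem by blast
    then have "c \<odot>\<^bsub>M\<^esub> x = c \<odot>\<^bsub>M\<^esub> u \<oplus>\<^bsub>M\<^esub> c \<odot>\<^bsub>M\<^esub> w" using U(1) W(1) x by (simp add: smult_r_distr subset_iff)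
    then show ?thesis using U(4) W(4) x \<open>u \<in> U\<close> \<open>w \<in> W\<close> unfolding mem by blast
  qed
qed

end

lemma submodule_vimage:
  assumes "module R V" "module R W" "f \<in> lin_maps R V W" "submodule Z R W"
  shows "submodule {x \<in> carrier V. f x \<in> Z} R V"
proof -
  interpret V: module R V by fact
  interpret W: module R W by fact
  note [simp] = lin_mapsD[OF assms(3)] lin_maps_group[OF V.M.abelian_group_axioms W.M.abelian_group_axioms assms(3)]
  show ?thesis
    by (rule V.submoduleI) (auto simp: W.submoduleE[OF assms(4)] W.submodule_zero_closed[OF assms(4)])
qed

text \<open>The span is available only as an intersection of submodules, so the containment comes
  from its minimality, applied to the preimage of \<open>Z\<close>.\<close>

lemma lin_span_image_subset:
  assumes "module R V" "module R W" "f \<in> lin_maps R V W" "submodule Z R W"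
    and "S \<subseteq> carrier V" "f ` S \<subseteq> Z"
  shows "f ` lin_span R V S \<subseteq> Z"
  using module.lin_span_minimal[OF assms(1) submodule_vimage[OF assms(1-4)], of S] assms(5,6) by blast


subsection \<open>Quotient spaces\<close>

context module
begin

lemma quotient_space_carrier:
  "carrier (quotient_space M W) = (\<lambda>x. W +>\<^bsub>M\<^esub> x) ` carrier M"
  by (auto simp: quotient_space_def A_RCOSETS_def' a_r_coset_def')

lemma coset_eq_iff:
  assumes "submodule W R M" "x \<in> carrier M" "y \<in> carrier M"
  shows "W +>\<^bsub>M\<^esub> x = W +>\<^bsub>M\<^esub> y \<longleftrightarrow> x \<ominus>\<^bsub>M\<^esub> y \<in> W"
proof -
  interpret W: abelian_subgroup W M using submodule_abelian_subgroup[OF assms(1)] .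
  show ?thesis
    using assms(2,3) W.a_rcos_module W.a_repr_independence' W.a_repr_independenceD
    unfolding M.minus_eq by metis
qed

lemma coset_mem_iff:
  assumes "submodule W R M" "x \<in> carrier M"
  shows "y \<in> W +>\<^bsub>M\<^esub> x \<longleftrightarrow> y \<in> carrier M \<and> y \<ominus>\<^bsub>M\<^esub> x \<in> W"
proof -
  interpret W: abelian_subgroup W M using submodule_abelian_subgroup[OF assms(1)] .
  show ?thesis
    using assms(2) W.a_rcos_module W.a_elemrcos_carrier unfolding M.minus_eq by metis
qed

text \<open>The common computation behind \<open>canonical_epi\<close>, scalar multiples of cosets
  and \<open>quotient_map\<close>: each adds \<open>W\<close> to a part of a coset, and that part
  may be smaller than the coset, for instance a single point after scaling by zero.\<close>

lemma set_add_eq_coset: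
  assumes W: "submodule W R M" and x: "x \<in> carrier M" "x \<in> X" and X: "X \<subseteq> W +>\<^bsub>M\<^esub> x"
  shows "W <+>\<^bsub>M\<^esub> X = W +>\<^bsub>M\<^esub> x"
proof
  note S = submoduleE[OF W]
  show "W +>\<^bsub>M\<^esub> x \<subseteq> W <+>\<^bsub>M\<^esub> X" using x by (auto simp: set_add_def' a_r_coset_def')
  show "W <+>\<^bsub>M\<^esub> X \<subseteq> W +>\<^bsub>M\<^esub> x"
  proof
    fix z assume "z \<in> W <+>\<^bsub>M\<^esub> X"
    then obtain w y where wy: "w \<in> W" "y \<in> X" "z = w \<oplus>\<^bsub>M\<^esub> y" by (auto simp: set_add_def')
    then obtain w' where w': "w' \<in> W" "y = w' \<oplus>\<^bsub>M\<^esub> x" using X by (auto simp: a_r_coset_def')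
    then have "z = (w \<oplus>\<^bsub>M\<^esub> w') \<oplus>\<^bsub>M\<^esub> x" using S(1) wy x by (simp add: M.a_assoc subset_iff)
    then show "z \<in> W +>\<^bsub>M\<^esub> x" using S(5) wy w' by (auto simp: a_r_coset_def')
  qed
qed

lemma canonical_epi_coset:
  assumes "submodule U R M" "submodule W R M" "U \<subseteq> W" "x \<in> carrier M"
  shows "canonical_epi M W (U +>\<^bsub>M\<^esub> x) = W +>\<^bsub>M\<^esub> x"
  unfolding canonical_epi_def
proof (rule set_add_eq_coset[OF assms(2,4)])
  show "x \<in> U +>\<^bsub>M\<^esub> x"
    using assms by (simp add: coset_mem_iff submodule_zero_closed M.r_neg M.minus_eq)
  show "U +>\<^bsub>M\<^esub> x \<subseteq> W +>\<^bsub>M\<^esub> x" using assms(3) by (auto simp: a_r_coset_def')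
qed

lemma quotient_space_add:
  assumes "submodule W R M" "x \<in> carrier M" "y \<in> carrier M"
  shows "(W +>\<^bsub>M\<^esub> x) \<oplus>\<^bsub>quotient_space M W\<^esub> (W +>\<^bsub>M\<^esub> y) = W +>\<^bsub>M\<^esub> (x \<oplus>\<^bsub>M\<^esub> y)"
  using abelian_subgroup.a_rcos_sum[OF submodule_abelian_subgroup] assms
  by (simp add: quotient_space_def)

lemma quotient_space_smult:
  assumes W: "submodule W R M" and c: "c \<in> carrier R" and x: "x \<in> carrier M"
  shows "c \<odot>\<^bsub>quotient_space M W\<^esub> (W +>\<^bsub>M\<^esub> x) = W +>\<^bsub>M\<^esub> (c \<odot>\<^bsub>M\<^esub> x)"
  unfolding quotient_space_def module.simps
proof (rule set_add_eq_coset[OF W])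
  have mem: "x \<in> W +>\<^bsub>M\<^esub> x"
    using assms by (simp add: coset_mem_iff submodule_zero_closed M.r_neg M.minus_eq)
  then show "c \<odot>\<^bsub>M\<^esub> x \<in> (\<lambda>x. c \<odot>\<^bsub>M\<^esub> x) ` (W +>\<^bsub>M\<^esub> x)" by auto
  show "(\<lambda>x. c \<odot>\<^bsub>M\<^esub> x) ` (W +>\<^bsub>M\<^esub> x) \<subseteq> W +>\<^bsub>M\<^esub> (c \<odot>\<^bsub>M\<^esub> x)"
    using submoduleE(1,4)[OF W] c x by (force simp: a_r_coset_def' smult_r_distr)
qed (use c x in simp)

lemma diff_add_closed:
  assumes W: "submodule W R M"
    and "a \<in> carrier M" "b \<in> carrier M" "c \<in> carrier M" "d \<in> carrier M"
    and "a \<ominus>\<^bsub>M\<^esub> b \<in> W" "c \<ominus>\<^bsub>M\<^esub> d \<in> W"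
  shows "(a \<oplus>\<^bsub>M\<^esub> c) \<ominus>\<^bsub>M\<^esub> (b \<oplus>\<^bsub>M\<^esub> d) \<in> W"
proof -
  have "(a \<oplus>\<^bsub>M\<^esub> c) \<ominus>\<^bsub>M\<^esub> (b \<oplus>\<^bsub>M\<^esub> d) = (a \<ominus>\<^bsub>M\<^esub> b) \<oplus>\<^bsub>M\<^esub> (c \<ominus>\<^bsub>M\<^esub> d)"
    using assms by (simp add: M.minus_eq M.minus_add M.a_ac)
  then show ?thesis using submoduleE(5)[OF W] assms by simp
qed

lemma diff_trans_closed:
  assumes W: "submodule W R M"
    and "a \<in> carrier M" "b \<in> carrier M" "c \<in> carrier M"
    and "a \<ominus>\<^bsub>M\<^esub> b \<in> W" "b \<ominus>\<^bsub>M\<^esub> c \<in> W"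
  shows "a \<ominus>\<^bsub>M\<^esub> c \<in> W"
  using assms by (simp add: coset_eq_iff[OF W, symmetric])

lemma diff_sym_closed:
  assumes W: "submodule W R M" and "a \<in> carrier M" "b \<in> carrier M" "a \<ominus>\<^bsub>M\<^esub> b \<in> W"
  shows "b \<ominus>\<^bsub>M\<^esub> a \<in> W"
  using assms by (simp add: coset_eq_iff[OF W, symmetric])

lemma diff_self_closed:
  assumes W: "submodule W R M" and "a \<in> carrier M"
  shows "a \<ominus>\<^bsub>M\<^esub> a \<in> W"
  using assms by (simp add: coset_eq_iff[OF W, symmetric])

end

text \<open>Same shape as \<open>canonical_epi\<close>: no representative is chosen, and adding
  \<open>Z\<close> completes the image of a coset to a full coset.\<close>

definition quotient_map ::
    "('k, 'w, 'e) module_scheme \<Rightarrow> 'w set \<Rightarrow> ('v \<Rightarrow> 'w) \<Rightarrow> 'v set \<Rightarrow> 'w set" where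
  "quotient_map W Z f X = Z <+>\<^bsub>W\<^esub> f ` X"

lemma quotient_map_coset:
  assumes "module R V" "module R W" "submodule U R V" "submodule Z R W"
    and f: "f \<in> lin_maps R V W" and UZ: "f ` U \<subseteq> Z" and x: "x \<in> carrier V"
  shows "quotient_map W Z f (U +>\<^bsub>V\<^esub> x) = Z +>\<^bsub>W\<^esub> f x"
proof -
  interpret V: module R V by fact
  interpret W: module R W by fact
  show ?thesis
    unfolding quotient_map_def
  proof (rule W.set_add_eq_coset[OF assms(4)])
    show "f x \<in> f ` (U +>\<^bsub>V\<^esub> x)"
      using assms(3) x by (auto simp: V.coset_mem_iff V.submodule_zero_closed V.M.r_neg V.M.minus_eq)
    show "f ` (U +>\<^bsub>V\<^esub> x) \<subseteq> Z +>\<^bsub>W\<^esub> f x"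
      using V.submoduleE(1)[OF assms(3)] UZ x lin_maps_add[OF f] by (force simp: a_r_coset_def')
  qed (use f x in \<open>simp add: lin_mapsD\<close>)
qed

text \<open>The map induced by \<open>g\<close> is a two-sided inverse, because equality of cosets
  is exactly congruence modulo the subspaces. Thus \<open>f\<close> itself may fail to be injective
  or surjective.\<close>

lemma quotient_map_lin_iso:
  assumes V: "module R V" and W: "module R W" and U: "submodule U R V" and Z: "submodule Z R W"
    and f: "f \<in> lin_maps R V W" and fU: "f ` U \<subseteq> Z"
    and g: "g \<in> lin_maps R W V" and gZ: "g ` Z \<subseteq> U"
    and gf: "\<And>x. x \<in> carrier V \<Longrightarrow> g (f x) \<ominus>\<^bsub>V\<^esub> x \<in> U"
    and fg: "\<And>y. y \<in> carrier W \<Longrightarrow> f (g y) \<ominus>\<^bsub>W\<^esub> y \<in> Z"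
  shows "quotient_map W Z f \<in> lin_isos R (quotient_space V U) (quotient_space W Z)"
proof -
  interpret V: module R V by fact
  interpret W: module R W by fact
  note [simp] = quotient_map_coset[OF V W U Z f fU] quotient_map_coset[OF W V Z U g gZ]
    V.quotient_space_carrier W.quotient_space_carrier lin_mapsD[OF f] lin_mapsD[OF g]
    V.quotient_space_add[OF U] W.quotient_space_add[OF Z]
    V.quotient_space_smult[OF U] W.quotient_space_smult[OF Z]
  have "quotient_map W Z f \<in> lin_maps R (quotient_space V U) (quotient_space W Z)"
    by (rule lin_mapsI) auto
  moreover have "bij_betw (quotient_map W Z f)
      (carrier (quotient_space V U)) (carrier (quotient_space W Z))"
    by (rule bij_betw_byWitness[where f' = "quotient_map V U g"])
      (auto simp: V.coset_eq_iff[OF U] W.coset_eq_iff[OF Z] gf fg)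
  ultimately show ?thesis by (simp add: lin_isos_def)
qed


subsection \<open>The Jacobson radical and its powers\<close>

lemma left_idealD:
  assumes "left_ideal I R"
  shows left_ideal_mult: "\<And>a x. a \<in> carrier R \<Longrightarrow> x \<in> I \<Longrightarrow> a \<otimes>\<^bsub>R\<^esub> x \<in> I"
    and left_ideal_subset: "I \<subseteq> carrier R"
    and left_ideal_zero: "\<zero>\<^bsub>R\<^esub> \<in> I"
    and left_ideal_add: "\<And>x y. x \<in> I \<Longrightarrow> y \<in> I \<Longrightarrow> x \<oplus>\<^bsub>R\<^esub> y \<in> I"
    and left_ideal_a_inv: "\<And>x. abelian_group R \<Longrightarrow> x \<in> I \<Longrightarrow> \<ominus>\<^bsub>R\<^esub> x \<in> I"
proof -
  interpret additive_subgroup I R using assms by (simp add: left_ideal_def)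
  show "a \<otimes>\<^bsub>R\<^esub> x \<in> I" if "a \<in> carrier R" "x \<in> I" for a x
    using assms that by (simp add: left_ideal_def)
  show "I \<subseteq> carrier R" by (rule a_subset)
  show "\<zero>\<^bsub>R\<^esub> \<in> I" by simp
  show "x \<oplus>\<^bsub>R\<^esub> y \<in> I" if "x \<in> I" "y \<in> I" for x y using that by simp
  show "\<ominus>\<^bsub>R\<^esub> x \<in> I" if "abelian_group R" "x \<in> I" for x using that by simp
qed

context ring
begin

lemma left_idealI:
  assumes "I \<subseteq> carrier R" "\<zero> \<in> I" "\<And>x y. x \<in> I \<Longrightarrow> y \<in> I \<Longrightarrow> x \<oplus> y \<in> I"
    and mult: "\<And>a x. a \<in> carrier R \<Longrightarrow> x \<in> I \<Longrightarrow> a \<otimes> x \<in> I"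
  shows "left_ideal I R"
proof -
  have "\<ominus> x \<in> I" if "x \<in> I" for x
    using mult[of "\<ominus> \<one>" x] that assms(1) by (auto simp: l_minus)
  then have "additive_subgroup I R"
    using assms by (auto intro!: additive_subgroupI add.subgroupI)
  then show ?thesis using mult by (simp add: left_ideal_def)
qed

lemma left_ideal_one: "left_ideal I R \<Longrightarrow> \<one> \<in> I \<Longrightarrow> I = carrier R"
  using left_ideal_mult[of I R _ \<one>] left_ideal_subset[of I R] by auto

lemma ex_maximal_left_ideal:
  assumes I: "left_ideal I R" and "\<one> \<notin> I"
  shows "\<exists>J. maximal_left_ideal J R \<and> I \<subseteq> J"
proof -
  \<comment> \<open>Properness is phrased as not containing one, a condition that passes to unions
    of chains.\<close>
  let ?\<A> = "{J. left_ideal J R \<and> I \<subseteq> J \<and> \<one> \<notin> J}"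
  have "\<exists>M\<in>?\<A>. \<forall>X\<in>?\<A>. M \<subseteq> X \<longrightarrow> X = M"
  proof (rule subset_Zorn_nonempty)
    show "?\<A> \<noteq> {}" using assms by auto
    fix C assume C: "C \<noteq> {}" "subset.chain ?\<A> C"
    then have mem: "\<And>J. J \<in> C \<Longrightarrow> left_ideal J R \<and> I \<subseteq> J \<and> \<one> \<notin> J"
      and lin: "\<And>J K. J \<in> C \<Longrightarrow> K \<in> C \<Longrightarrow> J \<subseteq> K \<or> K \<subseteq> J"
      by (auto simp: subset_chain_def)
    have "left_ideal (\<Union>C) R"
    proof (rule left_idealI)
      show "\<Union>C \<subseteq> carrier R" using mem left_ideal_subset by blast
      show "\<zero> \<in> \<Union>C" using C(1) mem left_ideal_zero by blast
      show "a \<otimes> x \<in> \<Union>C" if "a \<in> carrier R" "x \<in> \<Union>C" for a x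
      proof -
        obtain J where "J \<in> C" "x \<in> J" using \<open>x \<in> \<Union>C\<close> by (rule UnionE)
        then show ?thesis using mem[of J] left_ideal_mult[of J R a x] \<open>a \<in> carrier R\<close> by blast
      qed
      fix x y assume "x \<in> \<Union>C" "y \<in> \<Union>C"
      then obtain J where "J \<in> C" "x \<in> J" "y \<in> J" using lin by blast
      then show "x \<oplus> y \<in> \<Union>C" using mem left_ideal_add[of J R] by blast
    qed
    then show "\<Union>C \<in> ?\<A>" using C(1) mem by blast
  qed
  then obtain J where J: "left_ideal J R" "I \<subseteq> J" "\<one> \<notin> J"
    and max: "\<And>X. left_ideal X R \<Longrightarrow> I \<subseteq> X \<Longrightarrow> \<one> \<notin> X \<Longrightarrow> J \<subseteq> X \<Longrightarrow> X = J" by auto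
  have "maximal_left_ideal J R"
    unfolding maximal_left_ideal_def using J max left_ideal_one by blast
  then show ?thesis using J(2) by blast
qed

lemma left_ideal_jacobson_radical: "left_ideal (jacobson_radical R) R"
proof (rule left_idealI)
  have mem: "x \<in> jacobson_radical R \<longleftrightarrow> x \<in> carrier R \<and> (\<forall>I. maximal_left_ideal I R \<longrightarrow> x \<in> I)" for x
    by (auto simp: jacobson_radical_def)
  have I: "left_ideal I R" if "maximal_left_ideal I R" for I
    using that by (simp add: maximal_left_ideal_def)
  show "jacobson_radical R \<subseteq> carrier R" by (auto simp: mem)
  show "\<zero> \<in> jacobson_radical R" by (simp add: mem left_ideal_zero I)
  show "x \<oplus> y \<in> jacobson_radical R"
    if "x \<in> jacobson_radical R" "y \<in> jacobson_radical R" for x y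
    using that by (simp add: mem left_ideal_add I)
  show "a \<otimes> x \<in> jacobson_radical R" if "a \<in> carrier R" "x \<in> jacobson_radical R" for a x
    using that by (simp add: mem left_ideal_mult I)
qed

text \<open>The elementwise criterion that transfers along homomorphisms and through Jacobson's
  lemma. If the left ideal generated by \<open>\<one> \<ominus> y \<otimes> x\<close> were proper, a
  maximal left ideal above it would contain \<open>y \<otimes> x\<close> as well, hence one.
  Conversely, if a maximal \<open>I\<close> misses \<open>x\<close>, then \<open>I\<close> together
  with the multiples of \<open>x\<close> is everything, so some
  \<open>\<one> \<ominus> y \<otimes> x\<close> lies in \<open>I\<close>, and its left inverse puts
  one into \<open>I\<close>.\<close>

lemma jacobson_radical_iff:
  assumes x: "x \<in> carrier R"
  shows "x \<in> jacobson_radical R \<longleftrightarrow>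
    (\<forall>y\<in>carrier R. \<exists>u\<in>carrier R. u \<otimes> (\<one> \<ominus> y \<otimes> x) = \<one>)"
proof (intro iffI ballI)
  fix y assume xJ: "x \<in> jacobson_radical R" and y: "y \<in> carrier R"
  let ?z = "\<one> \<ominus> y \<otimes> x"
  let ?I = "(\<lambda>u. u \<otimes> ?z) ` carrier R"
  have z: "?z \<in> carrier R" using x y by simp
  have I: "left_ideal ?I R"
  proof (rule left_idealI)
    show "\<zero> \<in> ?I" using z by (auto intro!: image_eqI[of _ _ \<zero>])
    show "a \<oplus> b \<in> ?I" if ab: "a \<in> ?I" "b \<in> ?I" for a b
    proof -
      obtain u v where "u \<in> carrier R" "v \<in> carrier R" "a = u \<otimes> ?z" "b = v \<otimes> ?z" using ab by auto
      then show ?thesis using z by (auto intro!: image_eqI[of _ _ "u \<oplus> v"] simp: l_distr)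
    qed
    show "a \<otimes> b \<in> ?I" if ab: "a \<in> carrier R" "b \<in> ?I" for a b
    proof -
      obtain v where "v \<in> carrier R" "b = v \<otimes> ?z" using ab by auto
      then show ?thesis using z ab(1) by (auto intro!: image_eqI[of _ _ "a \<otimes> v"] simp: m_assoc)
    qed
  qed (use z in auto)
  have "\<one> \<in> ?I"
  proof (rule ccontr)
    assume "\<one> \<notin> ?I"
    then obtain J where J: "maximal_left_ideal J R" "?I \<subseteq> J"
      using ex_maximal_left_ideal[OF I] by blast
    then have lJ: "left_ideal J R" by (simp add: maximal_left_ideal_def)
    have "\<one> \<otimes> ?z \<in> J" using J(2) by blast
    then have "?z \<in> J" using z by simp
    moreover have "y \<otimes> x \<in> J"
      using xJ J(1) y left_ideal_mult[OF lJ] by (auto simp: jacobson_radical_def)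
    ultimately have "?z \<oplus> y \<otimes> x \<in> J" by (rule left_ideal_add[OF lJ])
    then have "\<one> \<in> J" using x y by (simp add: minus_eq a_assoc l_neg)
    then show False using left_ideal_one[OF lJ] J(1) by (simp add: maximal_left_ideal_def)
  qed
  then obtain u where "\<one> = u \<otimes> ?z" "u \<in> carrier R" by (rule imageE)
  then show "\<exists>u\<in>carrier R. u \<otimes> ?z = \<one>" by (intro bexI[of _ u]) simp_all
next
  assume inv: "\<forall>y\<in>carrier R. \<exists>u\<in>carrier R. u \<otimes> (\<one> \<ominus> y \<otimes> x) = \<one>"
  have "x \<in> I" if max: "maximal_left_ideal I R" for I
  proof (rule ccontr)
    assume xI: "x \<notin> I"
    have I: "left_ideal I R" using max by (simp add: maximal_left_ideal_def)
    note Isub = left_ideal_subset[OF I]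
    let ?J = "{i \<oplus> y \<otimes> x | i y. i \<in> I \<and> y \<in> carrier R}"
    have J: "left_ideal ?J R"
    proof (rule left_idealI)
      show "?J \<subseteq> carrier R" using Isub x by auto
      have "\<zero> = \<zero> \<oplus> \<zero> \<otimes> x" using x by simp
      then show "\<zero> \<in> ?J" using left_ideal_zero[OF I] by blast
      fix a assume "a \<in> ?J"
      then obtain i y where a: "i \<in> I" "y \<in> carrier R" "a = i \<oplus> y \<otimes> x" by auto
      show "a \<oplus> b \<in> ?J" if bJ: "b \<in> ?J" for b
      proof -
        obtain j z where b: "j \<in> I" "z \<in> carrier R" "b = j \<oplus> z \<otimes> x" using bJ by auto
        have "i \<in> carrier R" "j \<in> carrier R" using a b Isub by auto
        then have "a \<oplus> b = (i \<oplus> j) \<oplus> (y \<oplus> z) \<otimes> x" using a b x by (simp add: l_distr a_ac)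
        then show ?thesis using left_ideal_add[OF I] a b by blast
      qed
      show "b \<otimes> a \<in> ?J" if "b \<in> carrier R" for b
      proof -
        have "i \<in> carrier R" using a Isub by auto
        then have "b \<otimes> a = b \<otimes> i \<oplus> (b \<otimes> y) \<otimes> x" using a x that by (simp add: r_distr m_assoc)
        then show ?thesis using left_ideal_mult[OF I] a that by blast
      qed
    qed
    have "i = i \<oplus> \<zero> \<otimes> x" if "i \<in> I" for i using Isub x that by auto
    then have "I \<subseteq> ?J" by blast
    moreover have "x = \<zero> \<oplus> \<one> \<otimes> x" using x by simp
    then have "x \<in> ?J" using left_ideal_zero[OF I] by blast
    ultimately have "?J = carrier R" using max J xI unfolding maximal_left_ideal_def by blast
    then obtain i y where iy: "i \<in> I" "y \<in> carrier R" "\<one> = i \<oplus> y \<otimes> x"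
      using one_closed by blast
    then have "i \<in> carrier R" using Isub by auto
    then have "i = \<one> \<ominus> y \<otimes> x" using iy x by (simp add: minus_eq a_assoc r_neg)
    then obtain u where "u \<in> carrier R" "u \<otimes> i = \<one>" using inv iy(2) by auto
    then have "\<one> \<in> I" using left_ideal_mult[OF I] iy(1) by metis
    then show False using left_ideal_one[OF I] max by (simp add: maximal_left_ideal_def)
  qed
  then show "x \<in> jacobson_radical R" using x by (auto simp: jacobson_radical_def)
qed

lemma left_ideal_ideal_prod:
  assumes I: "left_ideal I R" and J: "left_ideal J R"
  shows "left_ideal (ideal_prod R I J) R"
proof (rule left_idealI)
  note sub = left_ideal_subset[OF I] left_ideal_subset[OF J]
  show car: "ideal_prod R I J \<subseteq> carrier R"
  proof
    fix x assume "x \<in> ideal_prod R I J"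
    then show "x \<in> carrier R" by induction (use sub in auto)
  qed
  have "\<zero> \<otimes> \<zero> \<in> ideal_prod R I J"
    by (rule ideal_prod.prod) (simp_all add: left_ideal_zero[OF I] left_ideal_zero[OF J])
  then show "\<zero> \<in> ideal_prod R I J" by simp
  show "a \<otimes> x \<in> ideal_prod R I J" if a: "a \<in> carrier R" and "x \<in> ideal_prod R I J" for a x
    using that(2)
  proof induction
    case (prod i j)
    then have "a \<otimes> (i \<otimes> j) = (a \<otimes> i) \<otimes> j" using sub a by (simp add: m_assoc subset_iff)
    then show ?case using prod left_ideal_mult[OF I a] by (metis ideal_prod.prod)
  next
    case (sum s1 s2)
    then have "a \<otimes> (s1 \<oplus> s2) = a \<otimes> s1 \<oplus> a \<otimes> s2" using car a by (simp add: r_distr subset_iff)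
    then show ?case using sum by (metis ideal_prod.sum)
  qed
qed (rule ideal_prod.sum)

text \<open>The power unfolds by recursion with the new factor on the right;
  \<open>sandwich_rad_power\<close> peels it off in this order.\<close>

lemma rad_power_0: "rad_power R 0 = carrier R"
  and rad_power_Suc: "rad_power R (Suc n) = ideal_prod R (rad_power R n) (jacobson_radical R)"
  by (simp_all add: rad_power_def ideals_set_def nat_pow_def)

lemma left_ideal_rad_power: "left_ideal (rad_power R n) R"
proof (induction n)
  case 0
  show ?case unfolding rad_power_0 by (rule left_idealI) simp_all
next
  case (Suc n)
  then show ?case
    unfolding rad_power_Suc by (rule left_ideal_ideal_prod) (rule left_ideal_jacobson_radical)
qed

end

text \<open>Surjectivity lifts the multiplier \<open>y\<close> to \<open>R\<close>; the left inverse
  found there is then mapped to \<open>S\<close>.\<close>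

lemma jacobson_radical_image:
  assumes "ring R" "ring S" and h: "h \<in> ring_hom R S" and surj: "h ` carrier R = carrier S"
  shows "h ` jacobson_radical R \<subseteq> jacobson_radical S"
proof
  interpret R: ring R by fact
  interpret S: ring S by fact
  interpret h: ring_hom_ring R S h by unfold_locales (rule h)
  fix z assume "z \<in> h ` jacobson_radical R"
  then obtain x where x: "x \<in> jacobson_radical R" "z = h x" by auto
  then have xc: "x \<in> carrier R" by (simp add: jacobson_radical_def)
  show "z \<in> jacobson_radical S"
  proof (subst S.jacobson_radical_iff)
    show "z \<in> carrier S" using x xc by simp
    show "\<forall>y\<in>carrier S. \<exists>u\<in>carrier S. u \<otimes>\<^bsub>S\<^esub> (\<one>\<^bsub>S\<^esub> \<ominus>\<^bsub>S\<^esub> y \<otimes>\<^bsub>S\<^esub> z) = \<one>\<^bsub>S\<^esub>"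
    proof
      fix y assume "y \<in> carrier S"
      then obtain y' where y': "y' \<in> carrier R" "y = h y'" using surj by auto
      then obtain u where u: "u \<in> carrier R" "u \<otimes>\<^bsub>R\<^esub> (\<one>\<^bsub>R\<^esub> \<ominus>\<^bsub>R\<^esub> y' \<otimes>\<^bsub>R\<^esub> x) = \<one>\<^bsub>R\<^esub>"
        using x R.jacobson_radical_iff[OF xc] by blast
      have "h u \<otimes>\<^bsub>S\<^esub> (\<one>\<^bsub>S\<^esub> \<ominus>\<^bsub>S\<^esub> y \<otimes>\<^bsub>S\<^esub> z) = h (u \<otimes>\<^bsub>R\<^esub> (\<one>\<^bsub>R\<^esub> \<ominus>\<^bsub>R\<^esub> y' \<otimes>\<^bsub>R\<^esub> x))"
        using u(1) y' x(2) xc by (simp add: R.minus_eq S.minus_eq)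
      then show "\<exists>u\<in>carrier S. u \<otimes>\<^bsub>S\<^esub> (\<one>\<^bsub>S\<^esub> \<ominus>\<^bsub>S\<^esub> y \<otimes>\<^bsub>S\<^esub> z) = \<one>\<^bsub>S\<^esub>"
        using u by (intro bexI[of _ "h u"]) simp_all
    qed
  qed
qed

lemma rad_power_image:
  assumes "ring R" "ring S" and h: "h \<in> ring_hom R S" and surj: "h ` carrier R = carrier S"
  shows "h ` rad_power R n \<subseteq> rad_power S n"
proof -
  interpret R: ring R by fact
  interpret S: ring S by fact
  note sub = left_ideal_subset[OF R.left_ideal_rad_power] left_ideal_subset[OF R.left_ideal_jacobson_radical]
  have prod_sub: "ideal_prod R (rad_power R n) (jacobson_radical R) \<subseteq> carrier R" for n
    by (rule left_ideal_subset[OF R.left_ideal_ideal_prod[OF R.left_ideal_rad_power R.left_ideal_jacobson_radical]])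
  have J: "h x \<in> jacobson_radical S" if "x \<in> jacobson_radical R" for x
    using jacobson_radical_image[OF assms] that by blast
  show ?thesis
  proof (induction n)
    case 0
    show ?case using surj by (simp add: R.rad_power_0 S.rad_power_0)
  next
    case (Suc n)
    have "h x \<in> ideal_prod S (rad_power S n) (jacobson_radical S)"
      if "x \<in> ideal_prod R (rad_power R n) (jacobson_radical R)" for x
      using that
    proof induction
      case (prod i j)
      then have "i \<in> carrier R" "j \<in> carrier R" using sub by blast+
      then have "h (i \<otimes>\<^bsub>R\<^esub> j) = h i \<otimes>\<^bsub>S\<^esub> h j" by (rule ring_hom_mult[OF h])
      moreover have "h i \<in> rad_power S n" using Suc prod(1) by blast
      ultimately show ?case using J[OF prod(2)] by (simp add: ideal_prod.prod)
    next
      case (sum a b)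
      then have "a \<in> carrier R" "b \<in> carrier R" using prod_sub by blast+
      then have "h (a \<oplus>\<^bsub>R\<^esub> b) = h a \<oplus>\<^bsub>S\<^esub> h b" by (rule ring_hom_add[OF h])
      then show ?case using sum by (simp add: ideal_prod.sum)
    qed
    then show ?case by (simp add: R.rad_power_Suc S.rad_power_Suc image_subset_iff)
  qed
qed


subsection \<open>Commutator spaces\<close>

context assoc_algebra
begin

lemma left_ideal_submodule:
  assumes I: "left_ideal I A"
  shows "submodule I F A"
proof (rule submoduleI)
  note sub = left_ideal_subset[OF I]
  show "I \<subseteq> carrier A" by (rule sub)
  show "\<zero>\<^bsub>A\<^esub> \<in> I" by (rule left_ideal_zero[OF I])
  show "\<ominus>\<^bsub>A\<^esub> x \<in> I" if "x \<in> I" for x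
    using left_ideal_a_inv[OF I A.is_abelian_group that] .
  show "x \<oplus>\<^bsub>A\<^esub> y \<in> I" if "x \<in> I" "y \<in> I" for x y by (rule left_ideal_add[OF I that])
  fix c x assume cx: "c \<in> carrier F" "x \<in> I"
  then have "x \<in> carrier A" using sub by blast
  then have "c \<odot>\<^bsub>A\<^esub> x = (c \<odot>\<^bsub>A\<^esub> \<one>\<^bsub>A\<^esub>) \<otimes>\<^bsub>A\<^esub> x" using cx(1) by (simp add: smult_mult_left)
  then show "c \<odot>\<^bsub>A\<^esub> x \<in> I" using left_ideal_mult[OF I, of "c \<odot>\<^bsub>A\<^esub> \<one>\<^bsub>A\<^esub>" x] cx by simp
qed

lemma commutators_subset:
  "{x \<otimes>\<^bsub>A\<^esub> y \<ominus>\<^bsub>A\<^esub> y \<otimes>\<^bsub>A\<^esub> x | x y. x \<in> carrier A \<and> y \<in> carrier A} \<subseteq> carrier A"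
  by auto

lemma commutator_space_submodule: "submodule (commutator_space F A) F A"
  unfolding commutator_space_def by (rule lin_span_submodule[OF commutators_subset])

lemma commutator_mem:
  assumes "x \<in> carrier A" "y \<in> carrier A"
  shows "x \<otimes>\<^bsub>A\<^esub> y \<ominus>\<^bsub>A\<^esub> y \<otimes>\<^bsub>A\<^esub> x \<in> commutator_space F A"
  unfolding commutator_space_def lin_span_def by (rule hull_inc) (use assms in blast)

lemma commutator_space_image_subset:
  assumes V: "module F V" and f: "f \<in> lin_maps F A V" and Z: "submodule Z F V"
    and comm: "\<And>x y. x \<in> carrier A \<Longrightarrow> y \<in> carrier A \<Longrightarrow>
      f (x \<otimes>\<^bsub>A\<^esub> y) \<ominus>\<^bsub>V\<^esub> f (y \<otimes>\<^bsub>A\<^esub> x) \<in> Z"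
  shows "f ` commutator_space F A \<subseteq> Z"
  unfolding commutator_space_def
proof (rule lin_span_image_subset[OF module_axioms V f Z commutators_subset])
  interpret V: module F V by fact
  show "f ` {x \<otimes>\<^bsub>A\<^esub> y \<ominus>\<^bsub>A\<^esub> y \<otimes>\<^bsub>A\<^esub> x |x y. x \<in> carrier A \<and> y \<in> carrier A} \<subseteq> Z"
    using comm lin_maps_minus[OF M.abelian_group_axioms V.M.abelian_group_axioms f]
    by (auto simp: image_subset_iff)
qed

lemma rad_power_submodule: "submodule (rad_power A n) F A"
  by (rule left_ideal_submodule[OF A.left_ideal_rad_power])

lemma KR_submodule: "submodule (KR F A n) F A"
  unfolding KR_def by (rule submodule_set_add[OF commutator_space_submodule rad_power_submodule])

lemma commutator_space_subset_KR: "commutator_space F A \<subseteq> KR F A n"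
proof
  fix x assume x: "x \<in> commutator_space F A"
  then have "x \<in> carrier A" using submoduleE(1)[OF commutator_space_submodule] by blast
  then have "x = x \<oplus>\<^bsub>A\<^esub> \<zero>\<^bsub>A\<^esub>" by simp
  then show "x \<in> KR F A n"
    using x submodule_zero_closed[OF rad_power_submodule] unfolding KR_def set_add_def' by blast
qed

end

section \<open>Linear maps compatible with commutators and radical powers\<close>

definition KR_maps ::
    "('k, 'c) ring_scheme \<Rightarrow> ('k, 'a, 'd) module_scheme \<Rightarrow> ('k, 'b, 'e) module_scheme
      \<Rightarrow> ('a \<Rightarrow> 'b) set" where
  "KR_maps F A B =
     {t \<in> lin_maps F A B. t ` commutator_space F A \<subseteq> commutator_space F B \<and>
        (\<forall>n. t ` rad_power A n \<subseteq> rad_power B n)}"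

text \<open>Inverses modulo commutators are what traces provide. They induce inverse maps on every
  quotient in question, since each \<open>KR F A n\<close> contains the commutator space, and the
  relation can be chained through intermediate algebras.\<close>

definition KR_equivalent ::
    "('k, 'c) ring_scheme \<Rightarrow> ('k, 'a, 'd) module_scheme \<Rightarrow> ('k, 'b, 'e) module_scheme
      \<Rightarrow> bool" where
  "KR_equivalent F A B \<longleftrightarrow>
     (\<exists>t\<in>KR_maps F A B. \<exists>s\<in>KR_maps F B A.
        (\<forall>x\<in>carrier A. s (t x) \<ominus>\<^bsub>A\<^esub> x \<in> commutator_space F A) \<and>
        (\<forall>y\<in>carrier B. t (s y) \<ominus>\<^bsub>B\<^esub> y \<in> commutator_space F B))"

lemma KR_equivalent_sym: "KR_equivalent F A B \<Longrightarrow> KR_equivalent F B A"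
  unfolding KR_equivalent_def by blast

lemma KR_maps_KR:
  assumes "assoc_algebra F A" "assoc_algebra F B" and t: "t \<in> KR_maps F A B"
  shows "t ` KR F A n \<subseteq> KR F B n"
proof
  interpret A: assoc_algebra F A by fact
  interpret B: assoc_algebra F B by fact
  fix z assume "z \<in> t ` KR F A n"
  then obtain x y where xy: "x \<in> commutator_space F A" "y \<in> rad_power A n" "z = t (x \<oplus>\<^bsub>A\<^esub> y)"
    unfolding KR_def set_add_def' by blast
  then have "x \<in> carrier A" "y \<in> carrier A"
    using A.submoduleE(1)[OF A.commutator_space_submodule]
      A.submoduleE(1)[OF A.rad_power_submodule] by blast+
  then have "z = t x \<oplus>\<^bsub>B\<^esub> t y" using t xy(3) by (simp add: KR_maps_def lin_maps_add[where R = F])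
  moreover have "t x \<in> commutator_space F B" "t y \<in> rad_power B n"
    using t xy(1,2) by (auto simp: KR_maps_def)
  ultimately show "z \<in> KR F B n" unfolding KR_def set_add_def' by blast
qed

lemma KR_maps_compose:
  assumes "t \<in> KR_maps F A B" "u \<in> KR_maps F B D"
  shows "(\<lambda>x. u (t x)) \<in> KR_maps F A D"
  using assms lin_maps_compose[of t F A B u D] by (force simp: KR_maps_def)

text \<open>One half of transitivity: the error of the inner pair at \<open>t x\<close> lies in the
  commutator space of \<open>B\<close>, which \<open>s\<close> carries into that of
  \<open>A\<close>; the error of the outer pair is then added.\<close>

lemma KR_maps_retract:
  assumes "assoc_algebra F A" "assoc_algebra F B"
    and t: "t \<in> KR_maps F A B" and s: "s \<in> KR_maps F B A"
    and t': "t' \<in> KR_maps F B D" and s': "s' \<in> KR_maps F D B"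
    and st: "\<And>x. x \<in> carrier A \<Longrightarrow> s (t x) \<ominus>\<^bsub>A\<^esub> x \<in> commutator_space F A"
    and st': "\<And>x. x \<in> carrier B \<Longrightarrow> s' (t' x) \<ominus>\<^bsub>B\<^esub> x \<in> commutator_space F B"
    and x: "x \<in> carrier A"
  shows "s (s' (t' (t x))) \<ominus>\<^bsub>A\<^esub> x \<in> commutator_space F A"
proof -
  interpret A: assoc_algebra F A by fact
  interpret B: assoc_algebra F B by fact
  have lin: "t \<in> lin_maps F A B" "s \<in> lin_maps F B A" "t' \<in> lin_maps F B D" "s' \<in> lin_maps F D B"
    using t s t' s' by (auto simp: KR_maps_def)
  note [simp] = lin[THEN lin_maps_closed]
  have "s (s' (t' (t x)) \<ominus>\<^bsub>B\<^esub> t x) \<in> commutator_space F A"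
    using st'[of "t x"] x s by (auto simp: KR_maps_def)
  then have "s (s' (t' (t x))) \<ominus>\<^bsub>A\<^esub> s (t x) \<in> commutator_space F A"
    using x by (simp add: lin_maps_minus[OF B.M.abelian_group_axioms A.M.abelian_group_axioms lin(2)])
  then show ?thesis
    by (rule A.diff_trans_closed[OF A.commutator_space_submodule, rotated 3]) (use st x in auto)
qed

lemma KR_equivalent_trans:
  assumes "assoc_algebra F A" "assoc_algebra F B" "assoc_algebra F D"
    and "KR_equivalent F A B" "KR_equivalent F B D"
  shows "KR_equivalent F A D"
proof -
  obtain t s where ts: "t \<in> KR_maps F A B" "s \<in> KR_maps F B A"
      "\<And>x. x \<in> carrier A \<Longrightarrow> s (t x) \<ominus>\<^bsub>A\<^esub> x \<in> commutator_space F A"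
      "\<And>y. y \<in> carrier B \<Longrightarrow> t (s y) \<ominus>\<^bsub>B\<^esub> y \<in> commutator_space F B"
    using assms(4) unfolding KR_equivalent_def by blast
  obtain t' s' where ts': "t' \<in> KR_maps F B D" "s' \<in> KR_maps F D B"
      "\<And>x. x \<in> carrier B \<Longrightarrow> s' (t' x) \<ominus>\<^bsub>B\<^esub> x \<in> commutator_space F B"
      "\<And>y. y \<in> carrier D \<Longrightarrow> t' (s' y) \<ominus>\<^bsub>D\<^esub> y \<in> commutator_space F D"
    using assms(5) unfolding KR_equivalent_def by blast
  show ?thesis
    unfolding KR_equivalent_def
    using KR_maps_retract[OF assms(1,2) ts(1,2) ts'(1,2) ts(3) ts'(3)]
      KR_maps_retract[OF assms(3,2) ts'(2,1) ts(2,1) ts'(4) ts(4)]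
      KR_maps_compose[OF ts(1) ts'(1)] KR_maps_compose[OF ts'(2) ts(2)]
    by (intro bexI[of _ "\<lambda>x. t' (t x)"] bexI[of _ "\<lambda>x. s (s' x)"]) auto
qed

text \<open>Commutators go to commutators under every homomorphism; surjectivity serves the radical
  and its zeroth power, the whole algebra.\<close>

lemma surjective_algebra_hom_KR_maps:
  assumes "assoc_algebra F A" "assoc_algebra F B"
    and h: "h \<in> lin_maps F A B" "h \<in> ring_hom A B" and surj: "h ` carrier A = carrier B"
  shows "h \<in> KR_maps F A B"
proof -
  interpret A: assoc_algebra F A by fact
  interpret B: assoc_algebra F B by fact
  have "h ` commutator_space F A \<subseteq> commutator_space F B"
    by (rule A.commutator_space_image_subset[OF B.module_axioms h(1) B.commutator_space_submodule])
      (simp add: ring_hom_mult[OF h(2)] B.commutator_mem ring_hom_closed[OF h(2)])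
  then show ?thesis
    using h(1) rad_power_image[OF A.A.ring_axioms B.A.ring_axioms h(2) surj] by (simp add: KR_maps_def)
qed

lemma algebra_iso_KR_equivalent:
  assumes "assoc_algebra F A" "assoc_algebra F B"
    and h: "h \<in> lin_maps F A B" "h \<in> ring_hom A B" and bij: "bij_betw h (carrier A) (carrier B)"
  shows "KR_equivalent F A B"
proof -
  interpret A: assoc_algebra F A by fact
  interpret B: assoc_algebra F B by fact
  define g where "g = inv_into (carrier A) h"
  have bij': "bij_betw g (carrier B) (carrier A)" unfolding g_def by (rule bij_betw_inv_into[OF bij])
  have gh: "g (h x) = x" if "x \<in> carrier A" for x
    using bij that by (simp add: g_def bij_betw_inv_into_left)
  have hg: "h (g y) = y" if "y \<in> carrier B" for y
    using bij that by (simp add: g_def bij_betw_inv_into_right)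
  have gc: "g y \<in> carrier A" if "y \<in> carrier B" for y using bij' that by (rule bij_betwE[rule_format])
  have "g \<in> ring_hom B A"
  proof (rule ring_hom_memI)
    show "g (x \<otimes>\<^bsub>B\<^esub> y) = g x \<otimes>\<^bsub>A\<^esub> g y" if "x \<in> carrier B" "y \<in> carrier B" for x y
      using that gh[of "g x \<otimes>\<^bsub>A\<^esub> g y"] ring_hom_mult[OF h(2), of "g x" "g y"] by (simp add: gc hg)
    show "g (x \<oplus>\<^bsub>B\<^esub> y) = g x \<oplus>\<^bsub>A\<^esub> g y" if "x \<in> carrier B" "y \<in> carrier B" for x y
      using that gh[of "g x \<oplus>\<^bsub>A\<^esub> g y"] ring_hom_add[OF h(2), of "g x" "g y"] by (simp add: gc hg)
    show "g \<one>\<^bsub>B\<^esub> = \<one>\<^bsub>A\<^esub>"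
      using gh[of "\<one>\<^bsub>A\<^esub>"] ring_hom_one[OF h(2)] by simp
  qed (rule gc)
  moreover have "g \<in> lin_maps F B A"
  proof (rule lin_mapsI)
    show "g (x \<oplus>\<^bsub>B\<^esub> y) = g x \<oplus>\<^bsub>A\<^esub> g y" if "x \<in> carrier B" "y \<in> carrier B" for x y
      using ring_hom_add[OF \<open>g \<in> ring_hom B A\<close> that] .
    show "g (c \<odot>\<^bsub>B\<^esub> x) = c \<odot>\<^bsub>A\<^esub> g x" if "c \<in> carrier F" "x \<in> carrier B" for c x
      using that gh[of "c \<odot>\<^bsub>A\<^esub> g x"] lin_maps_smult[OF h(1), of c "g x"] by (simp add: gc hg)
  qed (rule gc)
  ultimately have "h \<in> KR_maps F A B" "g \<in> KR_maps F B A"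
    using surjective_algebra_hom_KR_maps assms(1,2) h bij bij' by (auto simp: bij_betw_def)
  then show ?thesis
    unfolding KR_equivalent_def
    by (intro bexI[of _ h] bexI[of _ g])
      (auto simp: gh hg A.diff_self_closed[OF A.commutator_space_submodule]
        B.diff_self_closed[OF B.commutator_space_submodule])
qed

text \<open>All the isomorphisms are induced by one map \<open>t\<close>, so both ways round the
  square send the coset of \<open>x\<close> to the coset of \<open>t x\<close>.\<close>

lemma KR_equivalent_quotients:
  assumes "assoc_algebra F A" "assoc_algebra F B" and eq: "KR_equivalent F A B"
  shows "\<exists>\<phi> \<in> lin_isos F (quotient_space A (commutator_space F A))
                        (quotient_space B (commutator_space F B)).
           \<forall>n. \<exists>\<psi> \<in> lin_isos F (quotient_space A (KR F A n)) (quotient_space B (KR F B n)).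
             \<forall>U \<in> carrier (quotient_space A (commutator_space F A)).
               \<psi> (canonical_epi A (KR F A n) U) = canonical_epi B (KR F B n) (\<phi> U)"
proof -
  interpret A: assoc_algebra F A by fact
  interpret B: assoc_algebra F B by fact
  obtain t s where t: "t \<in> KR_maps F A B" and s: "s \<in> KR_maps F B A"
      and st: "\<And>x. x \<in> carrier A \<Longrightarrow> s (t x) \<ominus>\<^bsub>A\<^esub> x \<in> commutator_space F A"
      and ts: "\<And>y. y \<in> carrier B \<Longrightarrow> t (s y) \<ominus>\<^bsub>B\<^esub> y \<in> commutator_space F B"
    using eq unfolding KR_equivalent_def by blast
  have lt: "t \<in> lin_maps F A B" "t ` commutator_space F A \<subseteq> commutator_space F B"
    and ls: "s \<in> lin_maps F B A" "s ` commutator_space F B \<subseteq> commutator_space F A"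
    using t s by (auto simp: KR_maps_def)
  note KA = A.commutator_space_submodule and KB = B.commutator_space_submodule
  let ?\<phi> = "quotient_map B (commutator_space F B) t"
  show ?thesis
  proof (rule bexI[of _ ?\<phi>], rule allI)
    show "?\<phi> \<in> lin_isos F (quotient_space A (commutator_space F A))
                        (quotient_space B (commutator_space F B))"
      by (rule quotient_map_lin_iso[OF A.module_axioms B.module_axioms KA KB lt ls st ts])
    fix n
    note KRA = A.KR_submodule[of n] and KRB = B.KR_submodule[of n]
    have tn: "t ` KR F A n \<subseteq> KR F B n" and sn: "s ` KR F B n \<subseteq> KR F A n"
      using KR_maps_KR assms(1,2) t s by blast+
    let ?\<psi> = "quotient_map B (KR F B n) t"
    show "\<exists>\<psi> \<in> lin_isos F (quotient_space A (KR F A n)) (quotient_space B (KR F B n)).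
             \<forall>U \<in> carrier (quotient_space A (commutator_space F A)).
               \<psi> (canonical_epi A (KR F A n) U) = canonical_epi B (KR F B n) (?\<phi> U)"
    proof (rule bexI[of _ ?\<psi>], rule ballI)
      show "?\<psi> \<in> lin_isos F (quotient_space A (KR F A n)) (quotient_space B (KR F B n))"
        by (rule quotient_map_lin_iso[OF A.module_axioms B.module_axioms KRA KRB lt(1) tn ls(1) sn])
          (use st ts A.commutator_space_subset_KR B.commutator_space_subset_KR in blast)+
      fix U assume "U \<in> carrier (quotient_space A (commutator_space F A))"
      then obtain x where x: "x \<in> carrier A" "U = commutator_space F A +>\<^bsub>A\<^esub> x"
        by (auto simp: A.quotient_space_carrier)
      show "?\<psi> (canonical_epi A (KR F A n) U) = canonical_epi B (KR F B n) (?\<phi> U)"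
        using x(1) lin_maps_closed[OF lt(1)]
        by (simp add: x(2) A.canonical_epi_coset[OF KA KRA A.commutator_space_subset_KR]
            B.canonical_epi_coset[OF KB KRB B.commutator_space_subset_KR]
            quotient_map_coset[OF A.module_axioms B.module_axioms KA KB lt]
            quotient_map_coset[OF A.module_axioms B.module_axioms KRA KRB lt(1) tn])
    qed
  qed
qed


section \<open>Linear categories and their endomorphism algebras\<close>

locale linear_cat = field F for F :: "('k, 'c) ring_scheme" +
  fixes C :: "('k, 'o, 'm) linear_category"
  assumes hom_module: "\<lbrakk>X \<in> objects C; Y \<in> objects C\<rbrakk> \<Longrightarrow> module F (hom_space C X Y)"
    and id_closed: "X \<in> objects C \<Longrightarrow> id_arr C X \<in> arrows C X X"
    and comp_closed:
      "\<lbrakk>X \<in> objects C; Y \<in> objects C; Z \<in> objects C; f \<in> arrows C X Y; g \<in> arrows C Y Z\<rbrakk>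
       \<Longrightarrow> compose_arr C X Y Z g f \<in> arrows C X Z"
    and comp_assoc:
      "\<lbrakk>W \<in> objects C; X \<in> objects C; Y \<in> objects C; Z \<in> objects C;
        f \<in> arrows C W X; g \<in> arrows C X Y; h \<in> arrows C Y Z\<rbrakk>
       \<Longrightarrow> compose_arr C W Y Z h (compose_arr C W X Y g f) =
           compose_arr C W X Z (compose_arr C X Y Z h g) f"
    and comp_id_right:
      "\<lbrakk>X \<in> objects C; Y \<in> objects C; f \<in> arrows C X Y\<rbrakk>
       \<Longrightarrow> compose_arr C X X Y f (id_arr C X) = f"
    and comp_id_left:
      "\<lbrakk>X \<in> objects C; Y \<in> objects C; f \<in> arrows C X Y\<rbrakk>
       \<Longrightarrow> compose_arr C X Y Y (id_arr C Y) f = f"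
    and comp_right_linear:
      "\<lbrakk>X \<in> objects C; Y \<in> objects C; Z \<in> objects C; g \<in> arrows C Y Z\<rbrakk>
       \<Longrightarrow> (\<lambda>f. compose_arr C X Y Z g f) \<in> lin_maps F (hom_space C X Y) (hom_space C X Z)"
    and comp_left_linear:
      "\<lbrakk>X \<in> objects C; Y \<in> objects C; Z \<in> objects C; f \<in> arrows C X Y\<rbrakk>
       \<Longrightarrow> (\<lambda>g. compose_arr C X Y Z g f) \<in> lin_maps F (hom_space C Y Z) (hom_space C X Z)"
begin

text \<open>
  Diagrammatic order: \<open>seq X Y Z f g\<close> is first \<open>f\<close>, then \<open>g\<close>. With it the endomorphism
  algebra of the regular left module is the algebra itself rather than its opposite.
\<close>

abbreviation seq :: "'o \<Rightarrow> 'o \<Rightarrow> 'o \<Rightarrow> 'm \<Rightarrow> 'm \<Rightarrow> 'm" where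
  "seq X Y Z f g \<equiv> compose_arr C X Y Z g f"

abbreviation hom_add :: "'o \<Rightarrow> 'o \<Rightarrow> 'm \<Rightarrow> 'm \<Rightarrow> 'm" where
  "hom_add X Y \<equiv> add (hom_space C X Y)"

abbreviation hom_zero :: "'o \<Rightarrow> 'o \<Rightarrow> 'm" where
  "hom_zero X Y \<equiv> zero (hom_space C X Y)"

lemma hom_group: "\<lbrakk>X \<in> objects C; Y \<in> objects C\<rbrakk> \<Longrightarrow> abelian_group (hom_space C X Y)"
  using hom_module module.axioms(2) by blast

lemma hom_closed:
  assumes "X \<in> objects C" "Y \<in> objects C"
  shows hom_add_closed: "\<lbrakk>f \<in> arrows C X Y; g \<in> arrows C X Y\<rbrakk> \<Longrightarrow> hom_add X Y f g \<in> arrows C X Y"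
    and hom_zero_closed: "hom_zero X Y \<in> arrows C X Y"
    and hom_smult_closed:
      "\<lbrakk>c \<in> carrier F; f \<in> arrows C X Y\<rbrakk> \<Longrightarrow> c \<odot>\<^bsub>hom_space C X Y\<^esub> f \<in> arrows C X Y"
proof -
  interpret H: module F "hom_space C X Y" using hom_module assms .
  show "\<lbrakk>f \<in> arrows C X Y; g \<in> arrows C X Y\<rbrakk> \<Longrightarrow> hom_add X Y f g \<in> arrows C X Y" by simp
  show "hom_zero X Y \<in> arrows C X Y" by simp
  show "\<lbrakk>c \<in> carrier F; f \<in> arrows C X Y\<rbrakk> \<Longrightarrow> c \<odot>\<^bsub>hom_space C X Y\<^esub> f \<in> arrows C X Y" by simp
qed

lemma seq_assoc:
  "\<lbrakk>W \<in> objects C; X \<in> objects C; Y \<in> objects C; Z \<in> objects C;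
    f \<in> arrows C W X; g \<in> arrows C X Y; h \<in> arrows C Y Z\<rbrakk>
   \<Longrightarrow> seq W Y Z (seq W X Y f g) h = seq W X Z f (seq X Y Z g h)"
  by (rule comp_assoc)

lemma seq_linear:
  assumes "X \<in> objects C" "Y \<in> objects C" "Z \<in> objects C"
  shows seq_add_left: "\<lbrakk>f \<in> arrows C X Y; f' \<in> arrows C X Y; g \<in> arrows C Y Z\<rbrakk> \<Longrightarrow>
      seq X Y Z (hom_add X Y f f') g = hom_add X Z (seq X Y Z f g) (seq X Y Z f' g)"
    and seq_add_right: "\<lbrakk>f \<in> arrows C X Y; g \<in> arrows C Y Z; g' \<in> arrows C Y Z\<rbrakk> \<Longrightarrow>
      seq X Y Z f (hom_add Y Z g g') = hom_add X Z (seq X Y Z f g) (seq X Y Z f g')"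
    and seq_smult_left: "\<lbrakk>c \<in> carrier F; f \<in> arrows C X Y; g \<in> arrows C Y Z\<rbrakk> \<Longrightarrow>
      seq X Y Z (c \<odot>\<^bsub>hom_space C X Y\<^esub> f) g = c \<odot>\<^bsub>hom_space C X Z\<^esub> seq X Y Z f g"
    and seq_smult_right: "\<lbrakk>c \<in> carrier F; f \<in> arrows C X Y; g \<in> arrows C Y Z\<rbrakk> \<Longrightarrow>
      seq X Y Z f (c \<odot>\<^bsub>hom_space C Y Z\<^esub> g) = c \<odot>\<^bsub>hom_space C X Z\<^esub> seq X Y Z f g"
    and seq_zero_left: "g \<in> arrows C Y Z \<Longrightarrow> seq X Y Z (hom_zero X Y) g = hom_zero X Z"
    and seq_zero_right: "f \<in> arrows C X Y \<Longrightarrow> seq X Y Z f (hom_zero Y Z) = hom_zero X Z"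
  using lin_maps_add[OF comp_left_linear[OF assms]] lin_maps_add[OF comp_right_linear[OF assms]]
    lin_maps_smult[OF comp_left_linear[OF assms]] lin_maps_smult[OF comp_right_linear[OF assms]]
    lin_maps_zero[OF hom_group hom_group comp_left_linear[OF assms]]
    lin_maps_zero[OF hom_group hom_group comp_right_linear[OF assms]] assms
  by auto

lemma seq_minus:
  assumes "X \<in> objects C" "Y \<in> objects C" "Z \<in> objects C"
  shows seq_minus_left: "\<lbrakk>f \<in> arrows C X Y; f' \<in> arrows C X Y; g \<in> arrows C Y Z\<rbrakk> \<Longrightarrow>
      seq X Y Z (f \<ominus>\<^bsub>hom_space C X Y\<^esub> f') g = seq X Y Z f g \<ominus>\<^bsub>hom_space C X Z\<^esub> seq X Y Z f' g"
    and seq_minus_right: "\<lbrakk>f \<in> arrows C X Y; g \<in> arrows C Y Z; g' \<in> arrows C Y Z\<rbrakk> \<Longrightarrow>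
      seq X Y Z f (g \<ominus>\<^bsub>hom_space C Y Z\<^esub> g') = seq X Y Z f g \<ominus>\<^bsub>hom_space C X Z\<^esub> seq X Y Z f g'"
  using lin_maps_minus[OF hom_group hom_group comp_left_linear[OF assms]]
    lin_maps_minus[OF hom_group hom_group comp_right_linear[OF assms]] assms
  by auto

text \<open>Fills in the two multiplicative fields that a hom-space leaves meaningless; the additive
  part of the record is untouched, so the group structure carries over by equality of
  \<open>add_monoid\<close>.\<close>

definition end_algebra :: "'o \<Rightarrow> ('k, 'm) module" where
  "end_algebra X = (hom_space C X X)\<lparr>mult := seq X X X, one := id_arr C X\<rparr>"

lemma end_algebra_simps [simp]:
  "carrier (end_algebra X) = arrows C X X"
  "x \<otimes>\<^bsub>end_algebra X\<^esub> y = seq X X X x y"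
  "\<one>\<^bsub>end_algebra X\<^esub> = id_arr C X"
  "\<zero>\<^bsub>end_algebra X\<^esub> = hom_zero X X"
  "x \<oplus>\<^bsub>end_algebra X\<^esub> y = hom_add X X x y"
  "c \<odot>\<^bsub>end_algebra X\<^esub> x = c \<odot>\<^bsub>hom_space C X X\<^esub> x"
  by (simp_all add: end_algebra_def)

lemma end_algebra_minus [simp]:
  "x \<ominus>\<^bsub>end_algebra X\<^esub> y = x \<ominus>\<^bsub>hom_space C X X\<^esub> y"
  by (simp add: end_algebra_def a_minus_def a_inv_def)

lemma end_algebra:
  assumes X: "X \<in> objects C"
  shows "assoc_algebra F (end_algebra X)"
proof -
  interpret H: module F "hom_space C X X" using hom_module X X .
  have add_monoid: "add_monoid (end_algebra X) = add_monoid (hom_space C X X)"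
    by (simp add: end_algebra_def)
  have grp: "abelian_group (end_algebra X)"
    by (rule comm_group_abelian_groupI, unfold add_monoid, rule H.M.a_comm_group)
  have "monoid (end_algebra X)"
    by (rule monoidI)
      (simp_all add: X comp_closed id_closed seq_assoc comp_id_left comp_id_right)
  then have ring: "ring (end_algebra X)"
    by (rule ringI[OF grp]) (simp_all add: X seq_add_left seq_add_right)
  have module: "module F (end_algebra X)"
    by (rule moduleI[OF is_cring grp])
      (simp_all add: H.smult_l_distr H.smult_r_distr H.smult_assoc1)
  show ?thesis
    by (intro assoc_algebra.intro field_axioms module ring assoc_algebra_axioms.intro)
      (simp_all add: X seq_smult_left seq_smult_right)
qed

end


subsection \<open>Trace maps\<close>

context linear_cat
begin

text \<open>Each pair consists of an arrow \<open>s\<close> from \<open>X\<close> to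
  \<open>Y\<close> and an arrow \<open>r\<close> back; the list encodes the endomorphism
  \<open>\<Sum> s\<^sub>j r\<^sub>j\<close> of \<open>X\<close>, composed in diagrammatic
  order.\<close>

primrec factor_sum :: "'o \<Rightarrow> 'o \<Rightarrow> ('m \<times> 'm) list \<Rightarrow> 'm" where
  "factor_sum X Y [] = hom_zero X X"
| "factor_sum X Y (p # l) = hom_add X X (seq X Y X (fst p) (snd p)) (factor_sum X Y l)"

text \<open>The sum \<open>\<Sum> r\<^sub>j x s\<^sub>j\<close>, read from \<open>Y\<close> through
  \<open>X\<close> back to \<open>Y\<close>.\<close>

primrec trace :: "'o \<Rightarrow> 'o \<Rightarrow> ('m \<times> 'm) list \<Rightarrow> 'm \<Rightarrow> 'm" where
  "trace X Y [] x = hom_zero Y Y"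
| "trace X Y (p # l) x =
     hom_add Y Y (seq Y X Y (snd p) (seq X X Y x (fst p))) (trace X Y l x)"

end

locale two_objects = linear_cat F C for F :: "('k, 'c) ring_scheme" and C :: "('k, 'o, 'm) linear_category" +
  fixes X Y :: 'o
  assumes X [simp]: "X \<in> objects C" and Y [simp]: "Y \<in> objects C"
begin

abbreviation "EndX \<equiv> end_algebra X"
abbreviation "EndY \<equiv> end_algebra Y"
abbreviation "factorizations \<equiv> arrows C X Y \<times> arrows C Y X"

lemmas closed [simp] = comp_closed hom_add_closed hom_zero_closed hom_smult_closed id_closed

sublocale EndX: assoc_algebra F "end_algebra X" by (rule end_algebra) simp
sublocale EndY: assoc_algebra F "end_algebra Y" by (rule end_algebra) simp

abbreviation "KX \<equiv> commutator_space F EndX"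
abbreviation "KY \<equiv> commutator_space F EndY"

lemma factor_sum_closed [simp]:
  "set l \<subseteq> factorizations \<Longrightarrow> factor_sum X Y l \<in> arrows C X X"
  by (induction l) auto

lemma trace_closed [simp]:
  "set l \<subseteq> factorizations \<Longrightarrow> x \<in> arrows C X X \<Longrightarrow> trace X Y l x \<in> arrows C Y Y"
  by (induction l) auto

lemma trace_linear:
  assumes "set l \<subseteq> factorizations"
  shows "trace X Y l \<in> lin_maps F EndX EndY"
  using assms
proof (induction l)
  case Nil
  show ?case using EndY.r_zero[of "hom_zero Y Y"] EndY.smult_r_null by (auto intro!: lin_mapsI)
next
  case (Cons p l)
  then have p: "fst p \<in> arrows C X Y" "snd p \<in> arrows C Y X" and l: "set l \<subseteq> factorizations"
    and IH: "trace X Y l \<in> lin_maps F EndX EndY" by auto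
  note add = lin_maps_add[OF IH, simplified] and smult = lin_maps_smult[OF IH, simplified]
  show ?case
  proof (rule lin_mapsI)
    show "trace X Y (p # l) (x \<oplus>\<^bsub>EndX\<^esub> y) = trace X Y (p # l) x \<oplus>\<^bsub>EndY\<^esub> trace X Y (p # l) y"
      if "x \<in> carrier EndX" "y \<in> carrier EndX" for x y
      using that p l EndY.M.add.m_ac by (simp add: add seq_add_left seq_add_right)
    show "trace X Y (p # l) (c \<odot>\<^bsub>EndX\<^esub> x) = c \<odot>\<^bsub>EndY\<^esub> trace X Y (p # l) x"
      if "c \<in> carrier F" "x \<in> carrier EndX" for c x
      using that p l EndY.smult_r_distr by (simp add: smult seq_smult_left seq_smult_right)
  qed (use p l in simp)
qed

text \<open>In each summand \<open>r a b s\<close> is the product of the endomorphisms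
  \<open>r a\<close> and \<open>b s\<close> of \<open>Y\<close>. Exchanging them costs a commutator
  and leaves \<open>b s r a\<close>; summing, the factor in the middle is
  \<open>factor_sum X Y l\<close>, whatever its value.\<close>

lemma trace_swap:
  assumes "set l \<subseteq> factorizations" and a: "a \<in> arrows C X Y" and b: "b \<in> arrows C Y X"
  shows "trace X Y l (seq X Y X a b) \<ominus>\<^bsub>EndY\<^esub> seq Y X Y b (seq X X Y (factor_sum X Y l) a) \<in> KY"
  using assms(1)
proof (induction l)
  case Nil
  then show ?case
    using a b EndY.diff_self_closed[OF EndY.commutator_space_submodule, of "hom_zero Y Y"]
    by (simp add: seq_zero_left seq_zero_right)
next
  case (Cons p l)
  then have p: "fst p \<in> arrows C X Y" "snd p \<in> arrows C Y X" and l: "set l \<subseteq> factorizations"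
    and IH: "trace X Y l (seq X Y X a b) \<ominus>\<^bsub>EndY\<^esub> seq Y X Y b (seq X X Y (factor_sum X Y l) a) \<in> KY"
    by auto
  let ?u = "seq Y X Y (snd p) a" and ?v = "seq Y X Y b (fst p)"
  have "seq Y Y Y ?u ?v \<ominus>\<^bsub>EndY\<^esub> seq Y Y Y ?v ?u \<in> KY"
    using EndY.commutator_mem[of ?u ?v] p a b by simp
  then have "(seq Y Y Y ?u ?v \<oplus>\<^bsub>EndY\<^esub> trace X Y l (seq X Y X a b)) \<ominus>\<^bsub>EndY\<^esub>
      (seq Y Y Y ?v ?u \<oplus>\<^bsub>EndY\<^esub> seq Y X Y b (seq X X Y (factor_sum X Y l) a)) \<in> KY"
    by (intro EndY.diff_add_closed[OF EndY.commutator_space_submodule])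
      (use IH p l a b in simp_all)
  moreover have "trace X Y (p # l) (seq X Y X a b) =
      seq Y Y Y ?u ?v \<oplus>\<^bsub>EndY\<^esub> trace X Y l (seq X Y X a b)"
    using p a b by (simp add: seq_assoc)
  moreover have "seq Y X Y b (seq X X Y (factor_sum X Y (p # l)) a) =
      seq Y Y Y ?v ?u \<oplus>\<^bsub>EndY\<^esub> seq Y X Y b (seq X X Y (factor_sum X Y l) a)"
    using p l a b by (simp add: seq_assoc seq_add_left seq_add_right)
  ultimately show ?case by simp
qed

text \<open>With \<open>l' = l\<close> this is the trace property for products within End
  \<open>X\<close>. The second list exists for the induction: \<open>l\<close> keeps representing
  the identity while \<open>l'\<close> shrinks. Each pair \<open>(s, r)\<close> of \<open>l'\<close>
  contributes \<open>trace_swap\<close> for \<open>a = x s\<close> and \<open>b = r y\<close>, whose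
  result \<open>r y x s\<close> is a summand of the trace of \<open>y x\<close>.\<close>

lemma trace_mult:
  assumes l: "set l \<subseteq> factorizations" "factor_sum X Y l = id_arr C X"
    and l': "set l' \<subseteq> factorizations" and x: "x \<in> arrows C X X" and y: "y \<in> arrows C X X"
  shows "trace X Y l (seq X X X x (seq X X X (factor_sum X Y l') y)) \<ominus>\<^bsub>EndY\<^esub>
    trace X Y l' (seq X X X y x) \<in> KY"
  using l'
proof (induction l')
  case Nil
  have "trace X Y l (hom_zero X X) = hom_zero Y Y"
    using lin_maps_zero[OF EndX.M.abelian_group_axioms EndY.M.abelian_group_axioms trace_linear[OF l(1)]]
    by simp
  then show ?case
    using x y EndY.diff_self_closed[OF EndY.commutator_space_submodule, of "hom_zero Y Y"]
    by (simp add: seq_zero_left seq_zero_right)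
next
  case (Cons p l')
  then have p: "fst p \<in> arrows C X Y" "snd p \<in> arrows C Y X" and l': "set l' \<subseteq> factorizations"
    and IH: "trace X Y l (seq X X X x (seq X X X (factor_sum X Y l') y)) \<ominus>\<^bsub>EndY\<^esub>
      trace X Y l' (seq X X X y x) \<in> KY"
    by auto
  let ?a = "seq X X Y x (fst p)" and ?b = "seq Y X X (snd p) y"
  have "trace X Y l (seq X Y X ?a ?b) \<ominus>\<^bsub>EndY\<^esub> seq Y X Y ?b ?a \<in> KY"
    using trace_swap[OF l(1), of ?a ?b] p x y by (simp add: l(2) comp_id_left comp_id_right)
  then have "(trace X Y l (seq X Y X ?a ?b) \<oplus>\<^bsub>EndY\<^esub>
        trace X Y l (seq X X X x (seq X X X (factor_sum X Y l') y))) \<ominus>\<^bsub>EndY\<^esub>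
      (seq Y X Y ?b ?a \<oplus>\<^bsub>EndY\<^esub> trace X Y l' (seq X X X y x)) \<in> KY"
    by (intro EndY.diff_add_closed[OF EndY.commutator_space_submodule])
      (use IH p l l' x y in simp_all)
  moreover have "trace X Y l (seq X X X x (seq X X X (factor_sum X Y (p # l')) y)) =
      trace X Y l (seq X Y X ?a ?b) \<oplus>\<^bsub>EndY\<^esub>
        trace X Y l (seq X X X x (seq X X X (factor_sum X Y l') y))"
    using p l l' x y lin_maps_add[OF trace_linear[OF l(1)]]
    by (simp add: seq_assoc seq_add_left seq_add_right)
  moreover have "trace X Y (p # l') (seq X X X y x) =
      seq Y X Y ?b ?a \<oplus>\<^bsub>EndY\<^esub> trace X Y l' (seq X X X y x)"
    using p x y by (simp add: seq_assoc)
  ultimately show ?case by simp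
qed

text \<open>By linearity the outer trace acts on each \<open>r (x s)\<close>, and
  \<open>trace_swap\<close> with the two objects exchanged turns this into \<open>x s r\<close>
  modulo commutators.\<close>

lemma trace_trace:
  assumes l': "set l' \<subseteq> arrows C Y X \<times> arrows C X Y" "factor_sum Y X l' = id_arr C Y"
    and l: "set l \<subseteq> factorizations" and x: "x \<in> arrows C X X"
  shows "trace Y X l' (trace X Y l x) \<ominus>\<^bsub>EndX\<^esub> seq X X X x (factor_sum X Y l) \<in> KX"
proof -
  interpret swap: two_objects F C Y X by unfold_locales simp_all
  note lin = swap.trace_linear[OF l'(1)]
  show ?thesis
    using l
  proof (induction l)
    case Nil
    have "trace Y X l' (hom_zero Y Y) = hom_zero X X"
      using lin_maps_zero[OF EndY.M.abelian_group_axioms EndX.M.abelian_group_axioms lin] by simp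
    then show ?case
      using x EndX.diff_self_closed[OF EndX.commutator_space_submodule, of "hom_zero X X"]
      by (simp add: seq_zero_right)
  next
    case (Cons p l)
    then have p: "fst p \<in> arrows C X Y" "snd p \<in> arrows C Y X" and l: "set l \<subseteq> factorizations"
      and IH: "trace Y X l' (trace X Y l x) \<ominus>\<^bsub>EndX\<^esub> seq X X X x (factor_sum X Y l) \<in> KX"
      by auto
    let ?b = "seq X X Y x (fst p)"
    have "trace Y X l' (seq Y X Y (snd p) ?b) \<ominus>\<^bsub>EndX\<^esub> seq X Y X ?b (snd p) \<in> KX"
      using swap.trace_swap[OF l'(1), of "snd p" ?b] p x by (simp add: l'(2) comp_id_right)
    then have "(trace Y X l' (seq Y X Y (snd p) ?b) \<oplus>\<^bsub>EndX\<^esub> trace Y X l' (trace X Y l x)) \<ominus>\<^bsub>EndX\<^esub>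
        (seq X Y X ?b (snd p) \<oplus>\<^bsub>EndX\<^esub> seq X X X x (factor_sum X Y l)) \<in> KX"
      by (intro EndX.diff_add_closed[OF EndX.commutator_space_submodule])
        (use IH p l l' x in simp_all)
    moreover have "trace Y X l' (trace X Y (p # l) x) =
        trace Y X l' (seq Y X Y (snd p) ?b) \<oplus>\<^bsub>EndX\<^esub> trace Y X l' (trace X Y l x)"
      using p l x lin_maps_add[OF lin] by simp
    moreover have "seq X X X x (factor_sum X Y (p # l)) =
        seq X Y X ?b (snd p) \<oplus>\<^bsub>EndX\<^esub> seq X X X x (factor_sum X Y l)"
      using p l x by (simp add: seq_assoc seq_add_right)
    ultimately show ?case by simp
  qed
qed

text \<open>
  Jacobson's lemma: if \<open>u\<close> is a left inverse of \<open>1 - s m\<close> then \<open>1 + m u s\<close> is one of \<open>1 - m s\<close>.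
\<close>

lemma sandwich_jacobson_radical:
  assumes j: "j \<in> jacobson_radical EndX" and r: "r \<in> arrows C Y X" and s: "s \<in> arrows C X Y"
  shows "seq Y X Y r (seq X X Y j s) \<in> jacobson_radical EndY"
proof -
  have jX: "j \<in> arrows C X X" using j by (simp add: jacobson_radical_def)
  have "\<exists>u\<in>carrier EndY. u \<otimes>\<^bsub>EndY\<^esub> (\<one>\<^bsub>EndY\<^esub> \<ominus>\<^bsub>EndY\<^esub> d \<otimes>\<^bsub>EndY\<^esub> seq Y X Y r (seq X X Y j s)) = \<one>\<^bsub>EndY\<^esub>"
    if "d \<in> carrier EndY" for d
  proof -
    have d: "d \<in> arrows C Y Y" using that by simp
    \<comment> \<open>With \<open>m = d r j\<close>, the product under test is \<open>m s\<close> in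
      End \<open>Y\<close>, while the reversed product \<open>s m\<close> lies in End
      \<open>X\<close> and ends in \<open>j\<close>.\<close>
    let ?m = "seq Y X X (seq Y Y X d r) j"
    let ?w = "id_arr C Y \<ominus>\<^bsub>EndY\<^esub> seq Y X Y ?m s" and ?z = "id_arr C X \<ominus>\<^bsub>EndX\<^esub> seq X Y X s ?m"
    have m: "?m \<in> arrows C Y X" using d r jX by simp
    have w: "?w \<in> arrows C Y Y" and z: "?z \<in> arrows C X X"
      using EndY.M.minus_closed[of "id_arr C Y" "seq Y X Y ?m s"]
        EndX.M.minus_closed[of "id_arr C X" "seq X Y X s ?m"] m s by simp_all
    \<comment> \<open>The radical criterion for \<open>j\<close> with multiplier
      \<open>s d r\<close>, because \<open>s m = (s d r) j\<close>.\<close>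
    have "\<exists>u\<in>arrows C X X. seq X X X u ?z = id_arr C X"
      using EndX.A.jacobson_radical_iff[of j] j jX d r s
      by (auto simp: seq_assoc dest!: bspec[of _ _ "seq X Y X s (seq Y Y X d r)"])
    then obtain u where u: "u \<in> arrows C X X" "seq X X X u ?z = id_arr C X" by blast
    let ?v = "id_arr C Y \<oplus>\<^bsub>EndY\<^esub> seq Y X Y ?m (seq X X Y u s)"
    \<comment> \<open>\<open>s (1 - m s) = (1 - s m) s\<close> lets \<open>u\<close> cancel inside
      \<open>m u s (1 - m s)\<close>, leaving \<open>m s\<close>.\<close>
    have sw: "seq X Y Y s ?w = seq X X Y ?z s"
      using s m by (simp add: seq_minus_left seq_minus_right comp_id_left comp_id_right seq_assoc[of X Y X Y])
    have "seq Y Y Y ?v ?w = ?w \<oplus>\<^bsub>EndY\<^esub> seq Y X Y ?m (seq X X Y u (seq X Y Y s ?w))"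
      using w m u(1) s seq_assoc[of Y X Y Y ?m "seq X X Y u s" ?w] seq_assoc[of X X Y Y u s ?w]
      by (simp add: seq_add_left comp_id_right del: end_algebra_minus)
    also have "seq X X Y u (seq X Y Y s ?w) = s"
      unfolding sw using seq_assoc[of X X X Y u ?z s] u z s by (simp add: comp_id_right)
    also have "?w \<oplus>\<^bsub>EndY\<^esub> seq Y X Y ?m s = id_arr C Y"
      by (rule EndY.M.minus_add_cancel) (use m s in simp_all)
    finally have "seq Y Y Y ?v ?w = id_arr C Y" .
    moreover have "seq Y Y Y d (seq Y X Y r (seq X X Y j s)) = seq Y X Y ?m s"
      using d r s jX by (simp add: seq_assoc)
    ultimately show ?thesis using m u s by (intro bexI[of _ ?v]) simp_all
  qed
  then show ?thesis
    using EndY.A.jacobson_radical_iff[of "seq Y X Y r (seq X X Y j s)"] r s jX by simp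
qed

lemma rad_power_closed: "j \<in> rad_power EndX n \<Longrightarrow> j \<in> arrows C X X"
  using left_ideal_subset[OF EndX.A.left_ideal_rad_power, of n] by auto

text \<open>For a product of \<open>i\<close> in the lower power and \<open>k\<close> in the
  radical, inserting the identity of \<open>X\<close> gives
  \<open>r i k s = \<Sum> (r i s\<^sub>j) (r\<^sub>j k s)\<close>. The induction hypothesis covers
  the left factors and Jacobson's lemma the right ones; as \<open>s\<close> becomes
  \<open>s\<^sub>j\<close>, the outer arrows must be arbitrary in the induction.\<close>

lemma sandwich_rad_power:
  assumes l: "set l \<subseteq> factorizations" "factor_sum X Y l = id_arr C X"
    and r: "r \<in> arrows C Y X" and s: "s \<in> arrows C X Y" and j: "j \<in> rad_power EndX n"
  shows "seq Y X Y r (seq X X Y j s) \<in> rad_power EndY n"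
  using r s j
proof (induction n arbitrary: r s j)
  case 0
  then show ?case by (simp add: EndX.A.rad_power_0 EndY.A.rad_power_0)
next
  case (Suc n)
  note r = Suc.prems(1) and s = Suc.prems(2)
  \<comment> \<open>Proved for arbitrary lists, since the tail of a list representing the identity
    no longer represents it.\<close>
  have split: "seq Y X Y r (seq X X Y i (seq X X Y (factor_sum X Y l') (seq X X Y k s))) \<in> rad_power EndY (Suc n)"
    if i: "i \<in> rad_power EndX n" and k: "k \<in> jacobson_radical EndX" and "set l' \<subseteq> factorizations" for i k l'
    using that(3)
  proof (induction l')
    case Nil
    then show ?case
      using left_ideal_zero[OF EndY.A.left_ideal_rad_power] r s rad_power_closed[OF i] k
      by (simp add: seq_zero_left seq_zero_right jacobson_radical_def)
  next
    case (Cons p l')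
    have ik: "i \<in> arrows C X X" "k \<in> arrows C X X"
      using rad_power_closed[OF i] k by (simp_all add: jacobson_radical_def)
    from Cons have p: "fst p \<in> arrows C X Y" "snd p \<in> arrows C Y X" and l': "set l' \<subseteq> factorizations"
      and IH: "seq Y X Y r (seq X X Y i (seq X X Y (factor_sum X Y l') (seq X X Y k s))) \<in> rad_power EndY (Suc n)"
      by auto
    let ?a = "seq Y X Y r (seq X X Y i (fst p))" and ?b = "seq Y X Y (snd p) (seq X X Y k s)"
    have "?a \<otimes>\<^bsub>EndY\<^esub> ?b \<in> rad_power EndY (Suc n)"
      unfolding EndY.A.rad_power_Suc
      by (intro ideal_prod.prod Suc.IH sandwich_jacobson_radical r s p i k)
    then have "?a \<otimes>\<^bsub>EndY\<^esub> ?b \<oplus>\<^bsub>EndY\<^esub>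
        seq Y X Y r (seq X X Y i (seq X X Y (factor_sum X Y l') (seq X X Y k s))) \<in> rad_power EndY (Suc n)"
      using IH by (rule left_ideal_add[OF EndY.A.left_ideal_rad_power])
    then show ?case using p l' r s ik by (simp add: seq_assoc seq_add_left seq_add_right)
  qed
  have "j \<in> ideal_prod EndX (rad_power EndX n) (jacobson_radical EndX)"
    using Suc.prems(3) by (simp add: EndX.A.rad_power_Suc)
  then show ?case
  proof (induction j)
    case (prod i k)
    then have "i \<in> arrows C X X" "k \<in> arrows C X X"
      using rad_power_closed by (simp_all add: jacobson_radical_def)
    then show ?case using split[OF prod l(1)] r s by (simp add: l(2) comp_id_right seq_assoc)
  next
    case (sum a b)
    then have "a \<in> arrows C X X" "b \<in> arrows C X X"
      using rad_power_closed[of _ "Suc n"] by (simp_all add: EndX.A.rad_power_Suc)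
    then show ?case
      using left_ideal_add[OF EndY.A.left_ideal_rad_power sum.IH] r s
      by (simp add: seq_add_left seq_add_right)
  qed
qed

lemma trace_KR_maps:
  assumes l: "set l \<subseteq> factorizations" "factor_sum X Y l = id_arr C X"
  shows "trace X Y l \<in> KR_maps F EndX EndY"
proof -
  have comm: "trace X Y l ` KX \<subseteq> KY"
  proof (rule EndX.commutator_space_image_subset[OF EndY.module_axioms trace_linear[OF l(1)]
        EndY.commutator_space_submodule])
    show "trace X Y l (x \<otimes>\<^bsub>EndX\<^esub> y) \<ominus>\<^bsub>EndY\<^esub> trace X Y l (y \<otimes>\<^bsub>EndX\<^esub> x) \<in> KY"
      if "x \<in> carrier EndX" "y \<in> carrier EndX" for x y
      using that trace_mult[OF l l(1), of x y] by (simp add: l(2) comp_id_right)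
  qed
  \<comment> \<open>Again the list being summed is arbitrary; the fixed list \<open>l\<close>
    supplies the inserted identity in \<open>sandwich_rad_power\<close>.\<close>
  have "trace X Y l' x \<in> rad_power EndY n"
    if "set l' \<subseteq> factorizations" "x \<in> rad_power EndX n" for l' x n
    using that(1)
  proof (induction l')
    case Nil
    show ?case using left_ideal_zero[OF EndY.A.left_ideal_rad_power] by simp
  next
    case (Cons p l')
    then show ?case
      using sandwich_rad_power[OF l _ _ that(2), of "snd p" "fst p"]
        left_ideal_add[OF EndY.A.left_ideal_rad_power]
      by auto
  qed
  then show ?thesis using comm trace_linear[OF l(1)] l(1) by (auto simp: KR_maps_def)
qed

theorem end_algebra_KR_equivalent:
  assumes l: "set l \<subseteq> arrows C X Y \<times> arrows C Y X" "factor_sum X Y l = id_arr C X"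
    and l': "set l' \<subseteq> arrows C Y X \<times> arrows C X Y" "factor_sum Y X l' = id_arr C Y"
  shows "KR_equivalent F (end_algebra X) (end_algebra Y)"
proof -
  interpret swap: two_objects F C Y X by unfold_locales simp_all
  show ?thesis
    unfolding KR_equivalent_def
  proof (intro bexI conjI ballI)
    show "trace X Y l \<in> KR_maps F EndX EndY" by (rule trace_KR_maps[OF l])
    show "trace Y X l' \<in> KR_maps F EndY EndX" by (rule swap.trace_KR_maps[OF l'])
    show "trace Y X l' (trace X Y l x) \<ominus>\<^bsub>EndX\<^esub> x \<in> KX" if "x \<in> carrier EndX" for x
      using trace_trace[OF l' l(1), of x] that by (simp add: l(2) comp_id_left)
    show "trace X Y l (trace Y X l' y) \<ominus>\<^bsub>EndY\<^esub> y \<in> KY" if "y \<in> carrier EndY" for y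
      using swap.trace_trace[OF l l'(1), of y] that by (simp add: l'(2) comp_id_left)
  qed
qed

end


subsection \<open>Linear equivalences\<close>

context linear_cat
begin

text \<open>Faithfulness of the functor of arrows out of \<open>U\<close>, tested on zero because
  hom-sets are additive. The condition is purely categorical, hence survives equivalences.\<close>

definition generator :: "'o \<Rightarrow> bool" where
  "generator U \<longleftrightarrow> (\<forall>X\<in>objects C. \<forall>Y\<in>objects C. \<forall>f\<in>arrows C X Y.
     (\<forall>k\<in>arrows C U X. seq U X Y k f = hom_zero U Y) \<longrightarrow> f = hom_zero X Y)"

text \<open>In an additive setting this says that \<open>X\<close> is a direct summand of a finite
  power of \<open>Y\<close>.\<close>

definition resolves :: "('m \<times> 'm) list \<Rightarrow> 'o \<Rightarrow> 'o \<Rightarrow> bool" where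
  "resolves l X Y \<longleftrightarrow>
     set l \<subseteq> arrows C X Y \<times> arrows C Y X \<and> factor_sum X Y l = id_arr C X"

lemma iso_arrowsE:
  assumes "i \<in> iso_arrows C X Y"
  obtains j where "i \<in> arrows C X Y" "j \<in> arrows C Y X"
    "seq X Y X i j = id_arr C X" "seq Y X Y j i = id_arr C Y"
  using assms by (auto simp: iso_arrows_def)

lemma iso_cancel_right:
  assumes ob: "X \<in> objects C" "Y \<in> objects C" "Z \<in> objects C"
    and i: "i \<in> iso_arrows C Y Z"
    and f: "f \<in> arrows C X Y" and g: "g \<in> arrows C X Y" and eq: "seq X Y Z f i = seq X Y Z g i"
  shows "f = g"
proof -
  obtain j where j: "i \<in> arrows C Y Z" "j \<in> arrows C Z Y" "seq Y Z Y i j = id_arr C Y"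
    using i by (rule iso_arrowsE)
  have "seq X Z Y (seq X Y Z f i) j = seq X Z Y (seq X Y Z g i) j" using eq by simp
  then show ?thesis using ob f g j by (simp add: seq_assoc comp_id_left)
qed

lemma iso_cancel_left:
  assumes ob: "X \<in> objects C" "Y \<in> objects C" "Z \<in> objects C"
    and i: "i \<in> iso_arrows C X Y"
    and f: "f \<in> arrows C Y Z" and g: "g \<in> arrows C Y Z" and eq: "seq X Y Z i f = seq X Y Z i g"
  shows "f = g"
proof -
  obtain j where j: "i \<in> arrows C X Y" "j \<in> arrows C Y X" "seq Y X Y j i = id_arr C Y"
    using i by (rule iso_arrowsE)
  have "seq Y X Z j (seq X Y Z i f) = seq Y X Z j (seq X Y Z i g)" using eq by simp
  then show ?thesis
    using ob f g j by (simp add: seq_assoc[symmetric, of Y X Y Z j i] comp_id_right)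
qed

text \<open>Each composite \<open>s r\<close> is rewritten as \<open>(s i) (j r)\<close>, where
  \<open>j\<close> is the inverse of \<open>i\<close>.\<close>

lemma resolves_iso:
  assumes ob: "X \<in> objects C" "Y \<in> objects C" "Z \<in> objects C"
    and i: "i \<in> iso_arrows C Y Z" and l: "resolves l X Y"
  shows "\<exists>l'. resolves l' X Z"
proof -
  obtain j where j: "i \<in> arrows C Y Z" "j \<in> arrows C Z Y" "seq Y Z Y i j = id_arr C Y"
    using i by (rule iso_arrowsE)
  define l' where "l' = map (\<lambda>p. (seq X Y Z (fst p) i, seq Z Y X j (snd p))) l"
  have eq: "seq X Z X (seq X Y Z f i) (seq Z Y X j g) = seq X Y X f g"
    if "f \<in> arrows C X Y" "g \<in> arrows C Y X" for f g
    using ob that j by (simp add: seq_assoc comp_closed comp_id_right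
        seq_assoc[symmetric, of Y Z Y X i j g])
  have "set l \<subseteq> arrows C X Y \<times> arrows C Y X" using l by (simp add: resolves_def)
  then have "factor_sum X Z l' = factor_sum X Y l"
    unfolding l'_def by (induction l) (auto simp: eq)
  moreover have "set l' \<subseteq> arrows C X Z \<times> arrows C Z X"
    using l ob j(1,2) by (force simp: l'_def resolves_def comp_closed)
  ultimately show ?thesis using l by (auto simp: resolves_def)
qed

end

locale linear_equiv = C: linear_cat F C + D: linear_cat F D
  for F :: "('k, 'c) ring_scheme" and C :: "('k, 'o, 'm) linear_category"
    and D :: "('k, 'p, 'q) linear_category" +
  fixes T :: "('o, 'm, 'p, 'q) category_map" and S :: "('p, 'q, 'o, 'm) category_map"
  assumes T: "linear_functor F C D T" and S: "linear_functor F D C S"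
    and unit: "naturally_isomorphic C C (compose_functor S T) identity_functor"
    and counit: "naturally_isomorphic D D (compose_functor T S) identity_functor"
begin

text \<open>The hypotheses are symmetric, so every fact about \<open>T\<close> is also available for
  \<open>S\<close>.\<close>

lemma swap: "linear_equiv F D C S T"
  by (intro linear_equiv.intro linear_equiv_axioms.intro C.linear_cat_axioms D.linear_cat_axioms
      T S unit counit)

lemma T_object [simp]: "X \<in> objects C \<Longrightarrow> on_objects T X \<in> objects D"
  using T by (auto simp: linear_functor_def)

lemma T_linear:
  "\<lbrakk>X \<in> objects C; Y \<in> objects C\<rbrakk> \<Longrightarrow>
   on_arrows T X Y \<in> lin_maps F (hom_space C X Y) (hom_space D (on_objects T X) (on_objects T Y))"
  using T by (simp add: linear_functor_def)

lemma T_arrow [simp]: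
  "\<lbrakk>X \<in> objects C; Y \<in> objects C; f \<in> arrows C X Y\<rbrakk> \<Longrightarrow>
   on_arrows T X Y f \<in> arrows D (on_objects T X) (on_objects T Y)"
  by (rule lin_maps_closed[OF T_linear])

lemma T_zero [simp]:
  "\<lbrakk>X \<in> objects C; Y \<in> objects C\<rbrakk> \<Longrightarrow>
   on_arrows T X Y (C.hom_zero X Y) = D.hom_zero (on_objects T X) (on_objects T Y)"
  by (rule lin_maps_zero[OF C.hom_group D.hom_group T_linear]) simp_all

lemma T_id [simp]: "X \<in> objects C \<Longrightarrow> on_arrows T X X (id_arr C X) = id_arr D (on_objects T X)"
  using T by (simp add: linear_functor_def)

lemma T_seq:
  "\<lbrakk>X \<in> objects C; Y \<in> objects C; Z \<in> objects C; f \<in> arrows C X Y; g \<in> arrows C Y Z\<rbrakk> \<Longrightarrow>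
   on_arrows T X Z (C.seq X Y Z f g) =
   D.seq (on_objects T X) (on_objects T Y) (on_objects T Z) (on_arrows T X Y f) (on_arrows T Y Z g)"
  using T by (simp add: linear_functor_def)

lemma unitE:
  obtains \<eta> where
    "\<And>X. X \<in> objects C \<Longrightarrow> \<eta> X \<in> iso_arrows C (on_objects S (on_objects T X)) X"
    "\<And>X Y f. \<lbrakk>X \<in> objects C; Y \<in> objects C; f \<in> arrows C X Y\<rbrakk> \<Longrightarrow>
      C.seq (on_objects S (on_objects T X)) (on_objects S (on_objects T Y)) Y
        (on_arrows S (on_objects T X) (on_objects T Y) (on_arrows T X Y f)) (\<eta> Y) =
      C.seq (on_objects S (on_objects T X)) X Y (\<eta> X) f"
  using unit unfolding naturally_isomorphic_def compose_functor_def identity_functor_def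
  by (simp del: Collect_mem_eq) blast

end

text \<open>Naturality makes \<open>\<eta> X\<close> followed by \<open>f\<close> depend only on the
  image of \<open>f\<close> under \<open>T\<close>, and \<open>\<eta> X\<close> can be
  cancelled.\<close>

lemma (in linear_equiv) faithful:
  assumes ob: "X \<in> objects C" "Y \<in> objects C" and f: "f \<in> arrows C X Y" and g: "g \<in> arrows C X Y"
    and eq: "on_arrows T X Y f = on_arrows T X Y g"
  shows "f = g"
proof -
  interpret op: linear_equiv F D C S T by (rule swap)
  obtain \<eta> where \<eta>: "\<And>X. X \<in> objects C \<Longrightarrow> \<eta> X \<in> iso_arrows C (on_objects S (on_objects T X)) X"
    and nat: "\<And>X Y f. \<lbrakk>X \<in> objects C; Y \<in> objects C; f \<in> arrows C X Y\<rbrakk> \<Longrightarrow>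
      C.seq (on_objects S (on_objects T X)) (on_objects S (on_objects T Y)) Y
        (on_arrows S (on_objects T X) (on_objects T Y) (on_arrows T X Y f)) (\<eta> Y) =
      C.seq (on_objects S (on_objects T X)) X Y (\<eta> X) f"
    by (rule unitE) blast
  show ?thesis
    by (rule C.iso_cancel_left[OF _ ob \<eta>[OF ob(1)] f g])
      (use nat[OF ob f] nat[OF ob g] eq ob in simp_all)
qed

text \<open>The preimage is forced by naturality: the inverse of \<open>\<eta> X\<close>, then the
  image of \<open>h\<close> under \<open>S\<close>, then \<open>\<eta> Y\<close>. This gives the
  desired equality only after applying \<open>S\<close>, and faithfulness of \<open>S\<close>
  removes it.\<close>

lemma (in linear_equiv) full:
  assumes ob: "X \<in> objects C" "Y \<in> objects C" and h: "h \<in> arrows D (on_objects T X) (on_objects T Y)"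
  shows "\<exists>f\<in>arrows C X Y. on_arrows T X Y f = h"
proof -
  interpret op: linear_equiv F D C S T by (rule swap)
  obtain \<eta> where \<eta>: "\<And>X. X \<in> objects C \<Longrightarrow> \<eta> X \<in> iso_arrows C (on_objects S (on_objects T X)) X"
    and nat: "\<And>X Y f. \<lbrakk>X \<in> objects C; Y \<in> objects C; f \<in> arrows C X Y\<rbrakk> \<Longrightarrow>
      C.seq (on_objects S (on_objects T X)) (on_objects S (on_objects T Y)) Y
        (on_arrows S (on_objects T X) (on_objects T Y) (on_arrows T X Y f)) (\<eta> Y) =
      C.seq (on_objects S (on_objects T X)) X Y (\<eta> X) f"
    by (rule unitE) blast
  let ?X = "on_objects S (on_objects T X)" and ?Y = "on_objects S (on_objects T Y)"
  let ?h = "on_arrows S (on_objects T X) (on_objects T Y) h"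
  obtain j where j: "\<eta> X \<in> arrows C ?X X" "j \<in> arrows C X ?X"
    "C.seq ?X X ?X (\<eta> X) j = id_arr C ?X"
    using \<eta>[OF ob(1)] by (rule C.iso_arrowsE)
  have \<eta>Y: "\<eta> Y \<in> arrows C ?Y Y" using \<eta>[OF ob(2)] by (auto simp: iso_arrows_def)
  have hS: "?h \<in> arrows C ?X ?Y" using ob h by simp
  define f where "f = C.seq X ?X Y j (C.seq ?X ?Y Y ?h (\<eta> Y))"
  have f: "f \<in> arrows C X Y" unfolding f_def using ob j \<eta>Y hS by (simp add: C.comp_closed)
  have "C.seq ?X X Y (\<eta> X) f = C.seq ?X ?Y Y ?h (\<eta> Y)"
    unfolding f_def using ob j \<eta>Y hS
    by (simp add: C.comp_closed C.comp_id_right C.seq_assoc[symmetric, of ?X X ?X Y "\<eta> X" j])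
  then have "C.seq ?X ?Y Y (on_arrows S (on_objects T X) (on_objects T Y) (on_arrows T X Y f)) (\<eta> Y) =
      C.seq ?X ?Y Y ?h (\<eta> Y)"
    using nat[OF ob f] by simp
  then have "on_arrows S (on_objects T X) (on_objects T Y) (on_arrows T X Y f) = ?h"
    by (rule C.iso_cancel_right[OF _ _ _ \<eta>[OF ob(2)], rotated -1]) (use ob f hS in simp_all)
  then have "on_arrows T X Y f = h"
    by (rule op.faithful[rotated -1]) (use ob f h in simp_all)
  then show ?thesis using f by blast
qed

context linear_equiv
begin

lemma end_algebra_KR_equivalent_image:
  assumes X: "X \<in> objects C"
  shows "KR_equivalent F (C.end_algebra X) (D.end_algebra (on_objects T X))"
proof (rule algebra_iso_KR_equivalent[OF C.end_algebra D.end_algebra])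
  let ?h = "on_arrows T X X"
  show lin: "?h \<in> lin_maps F (C.end_algebra X) (D.end_algebra (on_objects T X))"
    using T_linear[OF X X] by (simp add: lin_maps_def)
  show "?h \<in> ring_hom (C.end_algebra X) (D.end_algebra (on_objects T X))"
    by (rule ring_hom_memI) (use X lin_maps_add[OF lin] in \<open>simp_all add: T_seq\<close>)
  show "bij_betw ?h (carrier (C.end_algebra X)) (carrier (D.end_algebra (on_objects T X)))"
    using full[OF X X] faithful[OF X X] X by (force simp: bij_betw_def inj_on_def)
qed (use X in simp_all)

lemma resolves_image:
  assumes ob: "X \<in> objects C" "Y \<in> objects C" and l: "C.resolves l X Y"
  shows "\<exists>l'. D.resolves l' (on_objects T X) (on_objects T Y)"
proof -
  define l' where "l' = map (\<lambda>p. (on_arrows T X Y (fst p), on_arrows T Y X (snd p))) l"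
  have car: "C.factor_sum X Y l \<in> arrows C X X" if "set l \<subseteq> arrows C X Y \<times> arrows C Y X" for l
    using that ob by (induction l) (auto simp: C.comp_closed C.hom_add_closed C.hom_zero_closed)
  have "set l \<subseteq> arrows C X Y \<times> arrows C Y X" using l by (simp add: C.resolves_def)
  then have "D.factor_sum (on_objects T X) (on_objects T Y) l' = on_arrows T X X (C.factor_sum X Y l)"
    unfolding l'_def
    by (induction l)
      (use ob lin_maps_add[OF T_linear[OF ob(1,1)]] in \<open>auto simp: car T_seq C.comp_closed\<close>)
  moreover have "set l' \<subseteq> arrows D (on_objects T X) (on_objects T Y) \<times> arrows D (on_objects T Y) (on_objects T X)"
    using l ob by (force simp: l'_def C.resolves_def)
  ultimately show ?thesis using l ob by (auto simp: C.resolves_def D.resolves_def)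
qed

text \<open>If \<open>p\<close> is killed by all arrows from the image of \<open>U\<close>, its
  image under \<open>S\<close> is killed by all \<open>k\<close> from \<open>U\<close>: after
  applying \<open>T\<close>, naturality of \<open>\<epsilon>\<close> moves the composite to one
  ending in \<open>p\<close>, which vanishes, and \<open>\<epsilon> W\<close> cancels. The generator
  property and faithfulness of \<open>S\<close> then give that \<open>p\<close> is zero.\<close>

lemma generator_image:
  assumes U: "U \<in> objects C" and gen: "C.generator U"
  shows "D.generator (on_objects T U)"
  unfolding D.generator_def
proof (intro ballI impI)
  interpret op: linear_equiv F D C S T by (rule swap)
  obtain \<epsilon> where \<epsilon>: "\<And>X. X \<in> objects D \<Longrightarrow> \<epsilon> X \<in> iso_arrows D (on_objects T (on_objects S X)) X"
    and nat: "\<And>X Y f. \<lbrakk>X \<in> objects D; Y \<in> objects D; f \<in> arrows D X Y\<rbrakk> \<Longrightarrow>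
      D.seq (on_objects T (on_objects S X)) (on_objects T (on_objects S Y)) Y
        (on_arrows T (on_objects S X) (on_objects S Y) (on_arrows S X Y f)) (\<epsilon> Y) =
      D.seq (on_objects T (on_objects S X)) X Y (\<epsilon> X) f"
    by (rule op.unitE) blast
  fix V W p
  assume ob: "V \<in> objects D" "W \<in> objects D" and p: "p \<in> arrows D V W"
    and zero: "\<forall>k\<in>arrows D (on_objects T U) V. D.seq (on_objects T U) V W k p = D.hom_zero (on_objects T U) W"
  let ?V = "on_objects T (on_objects S V)" and ?W = "on_objects T (on_objects S W)"
  let ?p = "on_arrows S V W p"
  have \<epsilon>V: "\<epsilon> V \<in> arrows D ?V V" and \<epsilon>W: "\<epsilon> W \<in> arrows D ?W W"
    using \<epsilon>[OF ob(1)] \<epsilon>[OF ob(2)] by (auto simp: iso_arrows_def)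
  have "C.seq U (on_objects S V) (on_objects S W) k ?p = C.hom_zero U (on_objects S W)"
    if k: "k \<in> arrows C U (on_objects S V)" for k
  proof (rule faithful[OF U])
    let ?k = "on_arrows T U (on_objects S V) k"
    have Tk: "?k \<in> arrows D (on_objects T U) ?V" using k U ob by simp
    have Tp: "on_arrows T (on_objects S V) (on_objects S W) ?p \<in> arrows D ?V ?W" using p ob by simp
    have "D.seq (on_objects T U) ?W W
        (D.seq (on_objects T U) ?V ?W ?k (on_arrows T (on_objects S V) (on_objects S W) ?p)) (\<epsilon> W)
      = D.seq (on_objects T U) V W (D.seq (on_objects T U) ?V V ?k (\<epsilon> V)) p"
      using nat[OF ob p] Tk Tp p \<epsilon>V \<epsilon>W ob U by (simp add: D.seq_assoc)
    also have "\<dots> = D.hom_zero (on_objects T U) W"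
      using zero Tk \<epsilon>V ob U by (simp add: D.comp_closed)
    also have "\<dots> = D.seq (on_objects T U) ?W W (D.hom_zero (on_objects T U) ?W) (\<epsilon> W)"
      using \<epsilon>W ob U by (simp add: D.seq_zero_left)
    finally have "D.seq (on_objects T U) ?V ?W ?k (on_arrows T (on_objects S V) (on_objects S W) ?p) =
        D.hom_zero (on_objects T U) ?W"
      by (rule D.iso_cancel_right[OF _ _ _ \<epsilon>[OF ob(2)], rotated -1])
        (use Tk Tp ob U in \<open>simp_all add: D.comp_closed D.hom_zero_closed\<close>)
    then show "on_arrows T U (on_objects S W) (C.seq U (on_objects S V) (on_objects S W) k ?p) =
        on_arrows T U (on_objects S W) (C.hom_zero U (on_objects S W))"
      using k p ob U by (simp add: T_seq)
  qed (use k p ob U in \<open>simp_all add: C.comp_closed C.hom_zero_closed\<close>)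
  then have "?p = C.hom_zero (on_objects S V) (on_objects S W)"
    using gen p ob unfolding C.generator_def by simp
  then show "p = D.hom_zero V W"
    using op.faithful[OF ob p, of "D.hom_zero V W"] ob by (simp add: D.hom_zero_closed)
qed

text \<open>Applying \<open>T\<close> to \<open>l'\<close> and moving along the isomorphism
  \<open>\<epsilon> V\<close> resolves the image of \<open>U\<close> through \<open>V\<close>; with
  \<open>l\<close> the two objects of \<open>D\<close> resolve each other, so the trace maps compare
  them.\<close>

theorem end_algebra_KR_equivalent:
  assumes U: "U \<in> objects C" and V: "V \<in> objects D"
    and l: "D.resolves l V (on_objects T U)" and l': "C.resolves l' U (on_objects S V)"
  shows "KR_equivalent F (C.end_algebra U) (D.end_algebra V)"
proof -
  interpret op: linear_equiv F D C S T by (rule swap)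
  obtain \<epsilon> where \<epsilon>: "\<And>X. X \<in> objects D \<Longrightarrow> \<epsilon> X \<in> iso_arrows D (on_objects T (on_objects S X)) X"
    by (rule op.unitE) blast
  obtain m where "D.resolves m (on_objects T U) (on_objects T (on_objects S V))"
    using resolves_image[OF U _ l'] V by auto
  then obtain m' where m': "D.resolves m' (on_objects T U) V"
    using D.resolves_iso[OF _ _ _ \<epsilon>[OF V]] U V by (metis T_object op.T_object)
  interpret TU_V: two_objects F D "on_objects T U" V
    by unfold_locales (use U V in simp_all)
  have "KR_equivalent F (D.end_algebra (on_objects T U)) (D.end_algebra V)"
    using TU_V.end_algebra_KR_equivalent l m' unfolding D.resolves_def by blast
  then show ?thesis
    using KR_equivalent_trans[OF C.end_algebra D.end_algebra D.end_algebra
        end_algebra_KR_equivalent_image] U V by simp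
qed

end


subsection \<open>The category of modules\<close>

context left_module
begin

lemma act_l_zero:
  assumes x: "x \<in> carrier M"
  shows "\<zero>\<^bsub>A\<^esub> \<odot>\<^bsub>M\<^esub> x = \<zero>\<^bsub>M\<^esub>"
proof -
  have "\<zero>\<^bsub>A\<^esub> \<odot>\<^bsub>M\<^esub> x \<oplus>\<^bsub>M\<^esub> \<zero>\<^bsub>A\<^esub> \<odot>\<^bsub>M\<^esub> x = \<zero>\<^bsub>A\<^esub> \<odot>\<^bsub>M\<^esub> x"
    using act_l_distr[of "\<zero>\<^bsub>A\<^esub>" "\<zero>\<^bsub>A\<^esub>" x] x by simp
  then show ?thesis using x by (simp add: M.add.l_cancel_one act_closed)
qed

lemma act_r_zero:
  assumes a: "a \<in> carrier A"
  shows "a \<odot>\<^bsub>M\<^esub> \<zero>\<^bsub>M\<^esub> = \<zero>\<^bsub>M\<^esub>"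
proof -
  have "a \<odot>\<^bsub>M\<^esub> \<zero>\<^bsub>M\<^esub> \<oplus>\<^bsub>M\<^esub> a \<odot>\<^bsub>M\<^esub> \<zero>\<^bsub>M\<^esub> = a \<odot>\<^bsub>M\<^esub> \<zero>\<^bsub>M\<^esub>"
    using act_r_distr[of a "\<zero>\<^bsub>M\<^esub>" "\<zero>\<^bsub>M\<^esub>"] a by simp
  then show ?thesis using a by (simp add: M.add.l_cancel_one act_closed)
qed

lemma act_r_minus:
  assumes a: "a \<in> carrier A" and x: "x \<in> carrier M"
  shows "a \<odot>\<^bsub>M\<^esub> (\<ominus>\<^bsub>M\<^esub> x) = \<ominus>\<^bsub>M\<^esub> (a \<odot>\<^bsub>M\<^esub> x)"
proof (rule M.minus_equality[symmetric])
  show "a \<odot>\<^bsub>M\<^esub> (\<ominus>\<^bsub>M\<^esub> x) \<oplus>\<^bsub>M\<^esub> a \<odot>\<^bsub>M\<^esub> x = \<zero>\<^bsub>M\<^esub>"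
    using a x by (simp flip: act_r_distr add: M.l_neg act_r_zero)
qed (use a x in \<open>simp_all add: act_closed\<close>)

lemma act_l_minus:
  assumes a: "a \<in> carrier A" and x: "x \<in> carrier M"
  shows "(\<ominus>\<^bsub>A\<^esub> a) \<odot>\<^bsub>M\<^esub> x = \<ominus>\<^bsub>M\<^esub> (a \<odot>\<^bsub>M\<^esub> x)"
proof (rule M.minus_equality[symmetric])
  show "(\<ominus>\<^bsub>A\<^esub> a) \<odot>\<^bsub>M\<^esub> x \<oplus>\<^bsub>M\<^esub> a \<odot>\<^bsub>M\<^esub> x = \<zero>\<^bsub>M\<^esub>"
    using a x by (simp flip: act_l_distr add: l_neg act_l_zero)
qed (use a x in \<open>simp_all add: act_closed\<close>)

end

lemma module_category_simps [simp]:
  "objects (module_category A) = {M. left_module A M}"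
  "hom_space (module_category A) M N = module_hom_space A M N"
  "id_arr (module_category A) M = (\<lambda>x\<in>carrier M. x)"
  "compose_arr (module_category A) L M N g f = compose (carrier L) g f"
  by (simp_all add: module_category_def)

lemma module_hom_space_simps [simp]:
  "carrier (module_hom_space A M N) = lin_maps A M N \<inter> extensional (carrier M)"
  "\<zero>\<^bsub>module_hom_space A M N\<^esub> = (\<lambda>x\<in>carrier M. \<zero>\<^bsub>N\<^esub>)"
  "f \<oplus>\<^bsub>module_hom_space A M N\<^esub> g = (\<lambda>x\<in>carrier M. f x \<oplus>\<^bsub>N\<^esub> g x)"
  "c \<odot>\<^bsub>module_hom_space A M N\<^esub> f = (\<lambda>x\<in>carrier M. (c \<odot>\<^bsub>A\<^esub> \<one>\<^bsub>A\<^esub>) \<odot>\<^bsub>N\<^esub> f x)"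
  by (simp_all add: module_hom_space_def)

text \<open>Lets linearity be checked on plain functions, although morphisms are extensional; the
  domain must be closed under its operations.\<close>

lemma restrict_lin_maps:
  assumes "left_module A M"
  shows "restrict f (carrier M) \<in> lin_maps A M N \<longleftrightarrow> f \<in> lin_maps A M N"
proof -
  interpret M: left_module A M by fact
  show ?thesis by (auto simp: lin_maps_def M.act_closed Pi_iff)
qed

context assoc_algebra
begin

text \<open>Centrality of scalars is what makes a scalar multiple of an \<open>A\<close>-linear map
  \<open>A\<close>-linear.\<close>

lemma scalar_central:
  assumes "c \<in> carrier F" "a \<in> carrier A"
  shows "a \<otimes>\<^bsub>A\<^esub> (c \<odot>\<^bsub>A\<^esub> \<one>\<^bsub>A\<^esub>) = (c \<odot>\<^bsub>A\<^esub> \<one>\<^bsub>A\<^esub>) \<otimes>\<^bsub>A\<^esub> a"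
  using assms by (simp add: smult_mult_left smult_mult_right)

lemma module_hom_space_module:
  assumes "left_module A M" "left_module A N"
  shows "module F (module_hom_space A M N)"
proof -
  interpret M: left_module A M by fact
  interpret N: left_module A N by fact
  let ?H = "module_hom_space A M N"
  have lin: "f x \<in> carrier N" if "f \<in> lin_maps A M N" "x \<in> carrier M" for f x
    using that by (rule lin_maps_closed)
  have add: "(\<lambda>x. f x \<oplus>\<^bsub>N\<^esub> g x) \<in> lin_maps A M N"
    if f: "f \<in> lin_maps A M N" and g: "g \<in> lin_maps A M N" for f g
    by (rule lin_mapsI)
      (simp_all add: lin_maps_add[OF f] lin_maps_add[OF g] lin_maps_smult[OF f] lin_maps_smult[OF g]
        lin[OF f] lin[OF g] N.act_r_distr N.M.a_ac)
  have smult: "(\<lambda>x. (c \<odot>\<^bsub>A\<^esub> \<one>\<^bsub>A\<^esub>) \<odot>\<^bsub>N\<^esub> f x) \<in> lin_maps A M N"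
    if f: "f \<in> lin_maps A M N" and c: "c \<in> carrier F" for c f
    by (rule lin_mapsI)
      (use c in \<open>simp_all add: lin_maps_add[OF f] lin_maps_smult[OF f]
        lin[OF f] N.act_r_distr N.act_closed scalar_central flip: N.act_assoc\<close>)
  have zero: "(\<lambda>x. \<zero>\<^bsub>N\<^esub>) \<in> lin_maps A M N"
    by (rule lin_mapsI) (simp_all add: N.act_r_zero)
  have neg: "(\<lambda>x. \<ominus>\<^bsub>N\<^esub> f x) \<in> lin_maps A M N" if f: "f \<in> lin_maps A M N" for f
    by (rule lin_mapsI)
      (simp_all add: lin_maps_add[OF f] lin_maps_smult[OF f] lin[OF f] N.act_r_minus N.M.minus_add)
  note [simp] = restrict_lin_maps[OF assms(1)] lin
  have "abelian_group ?H"
  proof (rule abelian_groupI)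
    show "\<exists>g\<in>carrier ?H. g \<oplus>\<^bsub>?H\<^esub> f = \<zero>\<^bsub>?H\<^esub>" if "f \<in> carrier ?H" for f
      using that neg by (intro bexI[of _ "\<lambda>x\<in>carrier M. \<ominus>\<^bsub>N\<^esub> f x"])
        (auto simp: N.M.l_neg intro!: restrict_ext)
  qed (auto simp: add zero N.M.a_ac intro!: restrict_ext extensionalityI[of _ "carrier M"])
  then show ?thesis
  proof (rule moduleI[OF is_cring])
    fix c d f assume c: "c \<in> carrier F" and d: "d \<in> carrier F" and f: "f \<in> carrier ?H"
    show "(c \<otimes>\<^bsub>F\<^esub> d) \<odot>\<^bsub>?H\<^esub> f = c \<odot>\<^bsub>?H\<^esub> (d \<odot>\<^bsub>?H\<^esub> f)"
      using c d f
      by (auto intro!: restrict_ext simp: smult_assoc1 smult_mult_left simp flip: N.act_assoc)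
  qed (auto simp: smult smult_l_distr N.act_l_distr N.act_r_distr N.act_one
      intro!: restrict_ext extensionalityI[of _ "carrier M"])
qed

lemma module_category_linear_cat:
  "linear_cat F (module_category A :: ('k, ('a, 'u) module, 'u \<Rightarrow> 'u) linear_category)"
proof (intro linear_cat.intro linear_cat_axioms.intro field_axioms)
  fix K L M N :: "('a, 'u) module" and f g h :: "'u \<Rightarrow> 'u"
  let ?C = "module_category A :: ('k, ('a, 'u) module, 'u \<Rightarrow> 'u) linear_category"
  have compose: "compose (carrier L) g f \<in> lin_maps A L N \<inter> extensional (carrier L)"
    if "left_module A L" "f \<in> lin_maps A L M" "g \<in> lin_maps A M N" for L M N f g
    using that lin_maps_compose[OF that(2,3)] by (simp add: compose_def restrict_lin_maps)
  {
    assume "L \<in> objects ?C" "M \<in> objects ?C"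
    then show "module F (hom_space ?C L M)" by (simp add: module_hom_space_module)
  next
    assume "L \<in> objects ?C"
    then show "id_arr ?C L \<in> arrows ?C L L" by (simp add: restrict_lin_maps) (simp add: lin_maps_def)
  next
    assume "L \<in> objects ?C" "f \<in> arrows ?C L M" "g \<in> arrows ?C M N"
    then show "compose_arr ?C L M N g f \<in> arrows ?C L N"
      using compose[of L f M g N] by simp
  next
    assume "f \<in> arrows ?C K L"
    then have "f \<in> carrier K \<rightarrow> carrier L" by (simp add: lin_maps_def)
    then show "compose_arr ?C K M N h (compose_arr ?C K L M g f) =
        compose_arr ?C K L N (compose_arr ?C L M N h g) f"
      by (simp add: compose_assoc)
  next
    assume "f \<in> arrows ?C L M"
    then have f: "f \<in> carrier L \<rightarrow> carrier M" "f \<in> extensional (carrier L)" by (simp_all add: lin_maps_def)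
    show "compose_arr ?C L L M f (id_arr ?C L) = f" using compose_Id[OF f] by simp
    show "compose_arr ?C L M M (id_arr ?C M) f = f" using Id_compose[OF f] by simp
  next
    assume ob: "L \<in> objects ?C" "M \<in> objects ?C" "N \<in> objects ?C" and g: "g \<in> arrows ?C M N"
    interpret M: left_module A M using ob by simp
    have g: "g \<in> lin_maps A M N" using g by simp
    show "(\<lambda>f. compose_arr ?C L M N g f) \<in> lin_maps F (hom_space ?C L M) (hom_space ?C L N)"
      using compose[OF _ _ g] ob
      by (intro lin_mapsI)
        (auto simp: compose_def lin_maps_closed lin_maps_add[OF g] lin_maps_smult[OF g] intro!: restrict_ext)
  next
    assume ob: "L \<in> objects ?C" "M \<in> objects ?C" "N \<in> objects ?C" and f: "f \<in> arrows ?C L M"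
    have f: "f \<in> lin_maps A L M" using f by simp
    show "(\<lambda>g. compose_arr ?C L M N g f) \<in> lin_maps F (hom_space ?C M N) (hom_space ?C L N)"
      using compose[OF _ f] ob
      by (intro lin_mapsI) (auto simp: compose_def lin_maps_closed[OF f] intro!: restrict_ext)
  }
qed

end


subsection \<open>Cyclic and regular modules\<close>

text \<open>
  The quotient \<open>A/I\<close>, realised inside the universe on a set of coset representatives.
\<close>

lemma (in assoc_algebra) ex_cyclic_module:
  fixes i :: "'a \<Rightarrow> 'u"
  assumes I: "left_ideal I A" and inj: "inj_on i (carrier A)"
  shows "\<exists>(W :: ('a, 'u) module) w. left_module A W \<and> w \<in> carrier W \<and>
    (\<forall>x\<in>carrier W. \<exists>a\<in>carrier A. x = a \<odot>\<^bsub>W\<^esub> w) \<and>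
    (\<forall>a\<in>carrier A. a \<odot>\<^bsub>W\<^esub> w = \<zero>\<^bsub>W\<^esub> \<longleftrightarrow> a \<in> I)"
proof -
  note sub = left_ideal_submodule[OF I]
  \<comment> \<open>The choice depends only on the coset, so \<open>f\<close> is the projection to
    the quotient followed by an embedding into the universe. Its partial inverse \<open>g\<close>
    returns some element of the coset, not necessarily the chosen one.\<close>
  define f where "f a = i (SOME y. y \<in> I +>\<^bsub>A\<^esub> a)" for a
  define g where "g = inv_into (carrier A) f"
  define W :: "('a, 'u) module" where
    "W = \<lparr>carrier = f ` carrier A, mult = undefined, one = undefined, zero = f \<zero>\<^bsub>A\<^esub>,
      add = (\<lambda>x y. f (g x \<oplus>\<^bsub>A\<^esub> g y)), smult = (\<lambda>a x. f (a \<otimes>\<^bsub>A\<^esub> g x))\<rparr>"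
  have f_eq: "f a = f b \<longleftrightarrow> a \<ominus>\<^bsub>A\<^esub> b \<in> I" if ab: "a \<in> carrier A" "b \<in> carrier A" for a b
  proof
    assume "a \<ominus>\<^bsub>A\<^esub> b \<in> I"
    then show "f a = f b" using ab by (simp add: f_def coset_eq_iff[OF sub, symmetric])
  next
    have mem: "(SOME y. y \<in> I +>\<^bsub>A\<^esub> c) \<in> I +>\<^bsub>A\<^esub> c" if "c \<in> carrier A" for c
      by (rule someI[of _ c]) (simp add: coset_mem_iff[OF sub that] that diff_self_closed[OF sub])
    assume "f a = f b"
    then have "(SOME y. y \<in> I +>\<^bsub>A\<^esub> a) = (SOME y. y \<in> I +>\<^bsub>A\<^esub> b)"
      using mem[OF ab(1)] mem[OF ab(2)] ab coset_mem_iff[OF sub]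
      by (auto simp: f_def intro: inj_onD[OF inj])
    then obtain y where "y \<in> I +>\<^bsub>A\<^esub> a" "y \<in> I +>\<^bsub>A\<^esub> b" using mem ab by metis
    then show "a \<ominus>\<^bsub>A\<^esub> b \<in> I"
      using ab diff_trans_closed[OF sub, of a y b] diff_sym_closed[OF sub, of y a]
      by (simp add: coset_mem_iff[OF sub])
  qed
  have gf: "g (f a) \<in> carrier A" "f (g (f a)) = f a" if "a \<in> carrier A" for a
    using that by (simp_all add: g_def inv_into_into f_inv_into_f)
  have gf_diff: "g (f a) \<ominus>\<^bsub>A\<^esub> a \<in> I" if "a \<in> carrier A" for a
    using f_eq[of "g (f a)" a] gf that by simp
  have add: "f a \<oplus>\<^bsub>W\<^esub> f b = f (a \<oplus>\<^bsub>A\<^esub> b)" if "a \<in> carrier A" "b \<in> carrier A" for a b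
    using that gf gf_diff diff_add_closed[OF sub, of "g (f a)" a "g (f b)" b]
    by (simp add: W_def f_eq)
  have act: "a \<odot>\<^bsub>W\<^esub> f b = f (a \<otimes>\<^bsub>A\<^esub> b)" if "a \<in> carrier A" "b \<in> carrier A" for a b
  proof -
    have "a \<otimes>\<^bsub>A\<^esub> g (f b) \<ominus>\<^bsub>A\<^esub> a \<otimes>\<^bsub>A\<^esub> b = a \<otimes>\<^bsub>A\<^esub> (g (f b) \<ominus>\<^bsub>A\<^esub> b)"
      using that gf by (simp add: M.minus_eq A.r_distr A.r_minus)
    also have "\<dots> \<in> I" using left_ideal_mult[OF I that(1)] gf_diff[OF that(2)] by simp
    finally show ?thesis using that gf by (simp add: W_def f_eq)
  qed
  have car: "carrier W = f ` carrier A" and zero: "\<zero>\<^bsub>W\<^esub> = f \<zero>\<^bsub>A\<^esub>" by (simp_all add: W_def)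
  have grp: "abelian_group W"
  proof (rule abelian_groupI)
    show "\<exists>y\<in>carrier W. y \<oplus>\<^bsub>W\<^esub> x = \<zero>\<^bsub>W\<^esub>" if "x \<in> carrier W" for x
    proof -
      obtain a where a: "a \<in> carrier A" "x = f a" using \<open>x \<in> carrier W\<close> by (auto simp: car)
      then have "f (\<ominus>\<^bsub>A\<^esub> a) \<oplus>\<^bsub>W\<^esub> x = \<zero>\<^bsub>W\<^esub>" by (simp add: add zero M.l_neg)
      then show ?thesis using a(1) by (intro bexI[of _ "f (\<ominus>\<^bsub>A\<^esub> a)"]) (simp_all add: car)
    qed
  qed (auto simp: car zero add M.a_ac)
  have W: "left_module A W"
    by (intro left_module.intro left_module_axioms.intro A.ring_axioms grp)
      (auto simp: car add act A.l_distr A.r_distr A.m_assoc)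
  show ?thesis
  proof (intro exI conjI ballI)
    show "left_module A W" by (rule W)
    show "f \<one>\<^bsub>A\<^esub> \<in> carrier W" by (simp add: car)
    show "\<exists>a\<in>carrier A. x = a \<odot>\<^bsub>W\<^esub> f \<one>\<^bsub>A\<^esub>" if "x \<in> carrier W" for x
      using that by (auto simp: car act)
    show "a \<odot>\<^bsub>W\<^esub> f \<one>\<^bsub>A\<^esub> = \<zero>\<^bsub>W\<^esub> \<longleftrightarrow> a \<in> I" if "a \<in> carrier A" for a
      using that by (simp add: act zero f_eq M.minus_eq)
  qed
qed

text \<open>A copy of the regular module in the universe: acting on the basis element
  \<open>u\<close> is a bijection from \<open>A\<close> to \<open>U\<close>.\<close>

locale regular_module = assoc_algebra F A + U: left_module A U
  for F :: "('k, 'c) ring_scheme" and A :: "('k, 'a, 'd) module_scheme"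
    and U :: "('a, 'u) module" +
  fixes u :: 'u
  assumes u [simp]: "u \<in> carrier U"
    and cyclic: "x \<in> carrier U \<Longrightarrow> \<exists>a\<in>carrier A. x = a \<odot>\<^bsub>U\<^esub> u"
    and free: "\<lbrakk>a \<in> carrier A; a \<odot>\<^bsub>U\<^esub> u = \<zero>\<^bsub>U\<^esub>\<rbrakk> \<Longrightarrow> a = \<zero>\<^bsub>A\<^esub>"
begin

abbreviation cat :: "('k, ('a, 'u) module, 'u \<Rightarrow> 'u) linear_category" where
  "cat \<equiv> module_category A"

sublocale cat: linear_cat F "module_category A :: ('k, ('a, 'u) module, 'u \<Rightarrow> 'u) linear_category"
  by (rule module_category_linear_cat)

lemma act_u_inj:
  assumes a: "a \<in> carrier A" and b: "b \<in> carrier A" and eq: "a \<odot>\<^bsub>U\<^esub> u = b \<odot>\<^bsub>U\<^esub> u"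
  shows "a = b"
proof -
  have "(a \<ominus>\<^bsub>A\<^esub> b) \<odot>\<^bsub>U\<^esub> u = \<zero>\<^bsub>U\<^esub>"
    using a b eq by (simp add: M.minus_eq U.act_l_distr U.act_l_minus U.act_closed U.M.r_neg)
  then have "a \<ominus>\<^bsub>A\<^esub> b = \<zero>\<^bsub>A\<^esub>" using a b by (intro free) simp_all
  then show ?thesis using a b M.minus_add_cancel[of a b] by simp
qed

text \<open>For \<open>n\<close> in a module \<open>N\<close>, the unique arrow sending
  \<open>u\<close> to \<open>n\<close>; the coefficient is unique by
  \<open>act_u_inj\<close>.\<close>

definition hom_from :: "('a, 'u) module \<Rightarrow> 'u \<Rightarrow> 'u \<Rightarrow> 'u" where
  "hom_from N n = (\<lambda>x\<in>carrier U. (THE a. a \<in> carrier A \<and> x = a \<odot>\<^bsub>U\<^esub> u) \<odot>\<^bsub>N\<^esub> n)"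

lemma hom_from_act: "a \<in> carrier A \<Longrightarrow> hom_from N n (a \<odot>\<^bsub>U\<^esub> u) = a \<odot>\<^bsub>N\<^esub> n"
proof -
  assume a: "a \<in> carrier A"
  then have "(THE b. b \<in> carrier A \<and> a \<odot>\<^bsub>U\<^esub> u = b \<odot>\<^bsub>U\<^esub> u) = a"
    by (intro the_equality) (auto intro: act_u_inj)
  then show ?thesis using a by (simp add: hom_from_def U.act_closed)
qed

lemma hom_from_arrow:
  assumes "left_module A N" "n \<in> carrier N"
  shows "hom_from N n \<in> arrows cat U N"
proof -
  interpret N: left_module A N by fact
  have "hom_from N n \<in> lin_maps A U N"
  proof (rule lin_mapsI)
    show "hom_from N n x \<in> carrier N" if "x \<in> carrier U" for x
      using cyclic[OF that] assms(2) by (auto simp: hom_from_act N.act_closed)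
    show "hom_from N n (x \<oplus>\<^bsub>U\<^esub> y) = hom_from N n x \<oplus>\<^bsub>N\<^esub> hom_from N n y"
      if x: "x \<in> carrier U" and y: "y \<in> carrier U" for x y
      using cyclic[OF x] cyclic[OF y] assms(2)
      by (auto simp: hom_from_act N.act_l_distr simp flip: U.act_l_distr)
    show "hom_from N n (a \<odot>\<^bsub>U\<^esub> x) = a \<odot>\<^bsub>N\<^esub> hom_from N n x"
      if a: "a \<in> carrier A" and x: "x \<in> carrier U" for a x
      using cyclic[OF x] a assms(2)
      by (auto simp: hom_from_act N.act_assoc simp flip: U.act_assoc)
  qed
  then show ?thesis by (simp add: hom_from_def)
qed

lemma hom_from_u [simp]:
  assumes "left_module A N" "n \<in> carrier N"
  shows "hom_from N n u = n"
  using hom_from_act[of "\<one>\<^bsub>A\<^esub>" N n] left_module.act_one[OF assms] by (simp add: U.act_one)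

lemma arrow_eqI:
  assumes f: "f \<in> arrows cat U N" and g: "g \<in> arrows cat U N" and eq: "f u = g u"
  shows "f = g"
proof (rule extensionalityI[of _ "carrier U"])
  fix x assume "x \<in> carrier U"
  then show "f x = g x"
    using cyclic[of x] f g eq by (auto simp: lin_maps_smult[where R = A])
qed (use f g in simp_all)

text \<open>Every element \<open>x\<close> of a module is the image of \<open>u\<close> under some
  arrow, so arrows out of \<open>U\<close> detect each value of \<open>f\<close>.\<close>

lemma generator_regular: "cat.generator U"
  unfolding cat.generator_def
proof (intro ballI impI)
  fix M N :: "('a, 'u) module" and f
  assume ob: "M \<in> objects cat" "N \<in> objects cat" and f: "f \<in> arrows cat M N"
    and zero: "\<forall>k\<in>arrows cat U M. cat.seq U M N k f = cat.hom_zero U N"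
  show "f = cat.hom_zero M N"
  proof (rule extensionalityI[of _ "carrier M"])
    fix x assume x: "x \<in> carrier M"
    have M: "left_module A M" using ob by simp
    have "cat.seq U M N (hom_from M x) f u = cat.hom_zero U N u"
      using zero hom_from_arrow[OF M x] by simp
    then show "f x = cat.hom_zero M N x" using M x by (simp add: compose_eq)
  qed (use f in simp_all)
qed

lemma KR_equivalent_end_algebra: "KR_equivalent F A (cat.end_algebra U)"
proof (rule algebra_iso_KR_equivalent)
  \<comment> \<open>Right multiplication by \<open>a\<close>. Diagrammatic composition makes it
    multiplicative rather than order-reversing, and every identity between arrows is checked at
    \<open>u\<close>.\<close>
  let ?h = "\<lambda>a. hom_from U (a \<odot>\<^bsub>U\<^esub> u)"
  have U: "left_module A U" by (rule U.left_module_axioms)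
  have act [simp]: "a \<odot>\<^bsub>U\<^esub> u \<in> carrier U" if "a \<in> carrier A" for a
    using that by (simp add: U.act_closed)
  show "assoc_algebra F A" by (rule assoc_algebra_axioms)
  show E: "assoc_algebra F (cat.end_algebra U)" by (rule cat.end_algebra) (simp add: U)
  interpret E: assoc_algebra F "cat.end_algebra U" by (rule E)
  have h: "?h a \<in> carrier (cat.end_algebra U)" if "a \<in> carrier A" for a
    using hom_from_arrow[OF U act[OF that]] by simp
  have hu: "?h a u = a \<odot>\<^bsub>U\<^esub> u" if "a \<in> carrier A" for a
    using that U by simp
  have eqI: "f = g" if "f \<in> carrier (cat.end_algebra U)" "g \<in> carrier (cat.end_algebra U)" "f u = g u" for f g
    using that by (intro arrow_eqI[of f U g]) simp_all
  have add: "?h (a \<oplus>\<^bsub>A\<^esub> b) = ?h a \<oplus>\<^bsub>cat.end_algebra U\<^esub> ?h b" if "a \<in> carrier A" "b \<in> carrier A" for a b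
    by (rule eqI[OF h E.M.a_closed[OF h h]]) (use that in \<open>simp_all add: U U.act_l_distr\<close>)
  show "?h \<in> lin_maps F A (cat.end_algebra U)"
  proof (rule lin_mapsI)
    show "?h (c \<odot>\<^bsub>A\<^esub> a) = c \<odot>\<^bsub>cat.end_algebra U\<^esub> ?h a" if "c \<in> carrier F" "a \<in> carrier A" for c a
      by (rule eqI[OF h E.smult_closed[OF _ h]])
        (use that in \<open>simp_all add: U smult_mult_left flip: U.act_assoc\<close>)
  qed (use h add in auto)
  show "?h \<in> ring_hom A (cat.end_algebra U)"
  proof (rule ring_hom_memI)
    show "?h (a \<otimes>\<^bsub>A\<^esub> b) = ?h a \<otimes>\<^bsub>cat.end_algebra U\<^esub> ?h b" if "a \<in> carrier A" "b \<in> carrier A" for a b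
      by (rule eqI[OF h E.A.m_closed[OF h h]])
        (use that in \<open>simp_all add: U compose_eq hom_from_act U.act_assoc U.act_closed\<close>)
    show "?h \<one>\<^bsub>A\<^esub> = \<one>\<^bsub>cat.end_algebra U\<^esub>"
      by (rule eqI[OF h E.A.one_closed]) (simp_all add: U U.act_one)
  qed (use h add in auto)
  show "bij_betw ?h (carrier A) (carrier (cat.end_algebra U))"
  proof (rule bij_betw_imageI)
    show "inj_on ?h (carrier A)"
      by (rule inj_onI) (metis hu act_u_inj)
    show "?h ` carrier A = carrier (cat.end_algebra U)"
    proof
      show "carrier (cat.end_algebra U) \<subseteq> ?h ` carrier A"
      proof
        fix f assume f: "f \<in> carrier (cat.end_algebra U)"
        then have "f u \<in> carrier U" by (simp add: lin_maps_closed[where R = A and V = U])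
        then obtain a where a: "a \<in> carrier A" "f u = a \<odot>\<^bsub>U\<^esub> u" using cyclic by blast
        then have "f = ?h a" using f h[OF a(1)] hu[OF a(1)] by (intro eqI) simp_all
        then show "f \<in> ?h ` carrier A" using a(1) by blast
      qed
    qed (use h in blast)
  qed
qed

end


section \<open>Trace ideals of generators\<close>

context regular_module
begin

lemma factor_sum_arrow:
  assumes "left_module A P" "set l \<subseteq> arrows cat U P \<times> arrows cat P U"
  shows "cat.factor_sum U P l \<in> arrows cat U U"
proof -
  interpret two_objects F cat U P
    by unfold_locales (simp_all add: assms(1) U.left_module_axioms)
  show ?thesis using assms(2) by (rule factor_sum_closed)
qed

lemma factor_sum_at_u:
  "cat.factor_sum U P [] u = \<zero>\<^bsub>U\<^esub>"
  "s \<in> arrows cat U P \<Longrightarrow>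
   cat.factor_sum U P ((s, r) # l) u = r (s u) \<oplus>\<^bsub>U\<^esub> cat.factor_sum U P l u"
  by (simp_all add: compose_eq)

lemma factor_sum_append_at_u:
  assumes "left_module A P" "set l \<subseteq> arrows cat U P \<times> arrows cat P U"
    "set l' \<subseteq> arrows cat U P \<times> arrows cat P U"
  shows "cat.factor_sum U P (l @ l') u = cat.factor_sum U P l u \<oplus>\<^bsub>U\<^esub> cat.factor_sum U P l' u"
  using assms(2)
proof (induction l)
  case Nil
  have "cat.factor_sum U P l' u \<in> carrier U"
    using factor_sum_arrow[OF assms(1,3)] by (simp add: lin_maps_closed[where R = A and V = U] lin_maps_closed[where R = A and V = P])
  then show ?case by simp
next
  case (Cons p l)
  obtain s r where p: "p = (s, r)" by (cases p)
  have sr: "s \<in> arrows cat U P" "r \<in> arrows cat P U" and l: "set l \<subseteq> arrows cat U P \<times> arrows cat P U"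
    using Cons.prems p by auto
  have "r (s u) \<in> carrier U" "cat.factor_sum U P l u \<in> carrier U" "cat.factor_sum U P l' u \<in> carrier U"
    using sr factor_sum_arrow[OF assms(1) l] factor_sum_arrow[OF assms(1,3)]
    by (simp_all add: lin_maps_closed[where R = A and V = U] lin_maps_closed[where R = A and V = P])
  then show ?case
    using Cons.IH[OF l] by (simp add: p factor_sum_at_u(2)[OF sr(1)] U.M.a_assoc del: cat.factor_sum.simps)
qed

lemma factor_sum_scale_at_u:
  assumes P: "left_module A P" and "set l \<subseteq> arrows cat U P \<times> arrows cat P U" and a: "a \<in> carrier A"
  shows "\<exists>l'. set l' \<subseteq> arrows cat U P \<times> arrows cat P U \<and>
    cat.factor_sum U P l' u = a \<odot>\<^bsub>U\<^esub> cat.factor_sum U P l u"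
  using assms(2)
proof (induction l)
  case Nil
  show ?case by (rule exI[of _ "[]"]) (simp add: a U.act_r_zero)
next
  case (Cons p l)
  obtain s r where p: "p = (s, r)" by (cases p)
  have s: "s \<in> arrows cat U P" and r: "r \<in> arrows cat P U" and l: "set l \<subseteq> arrows cat U P \<times> arrows cat P U"
    using Cons.prems p by auto
  obtain l' where l': "set l' \<subseteq> arrows cat U P \<times> arrows cat P U"
    "cat.factor_sum U P l' u = a \<odot>\<^bsub>U\<^esub> cat.factor_sum U P l u"
    using Cons.IH[OF l] by blast
  have su: "s u \<in> carrier P" using s by (simp add: lin_maps_closed[where R = A and V = U] lin_maps_closed[where R = A and V = P])
  then have asu: "a \<odot>\<^bsub>P\<^esub> s u \<in> carrier P" using a by (simp add: left_module.act_closed[OF P])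
  let ?s = "hom_from P (a \<odot>\<^bsub>P\<^esub> s u)"
  have s': "?s \<in> arrows cat U P" by (rule hom_from_arrow[OF P asu])
  have "cat.factor_sum U P l u \<in> carrier U"
    using factor_sum_arrow[OF P l] by (simp add: lin_maps_closed[where R = A and V = U] lin_maps_closed[where R = A and V = P])
  moreover have "r (s u) \<in> carrier U" "r (a \<odot>\<^bsub>P\<^esub> s u) = a \<odot>\<^bsub>U\<^esub> r (s u)"
    using r su a by (simp_all add: lin_maps_closed[where R = A and V = U] lin_maps_closed[where R = A and V = P] lin_maps_smult[where R = A and V = P])
  ultimately have "cat.factor_sum U P ((?s, r) # l') u = a \<odot>\<^bsub>U\<^esub> cat.factor_sum U P (p # l) u"
    using l'(2) a P asu unfolding p factor_sum_at_u(2)[OF s'] factor_sum_at_u(2)[OF s]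
    by (simp add: U.act_r_distr)
  then show ?case using l'(1) s' r by (intro exI[of _ "(?s, r) # l'"]) auto
qed

text \<open>
  The elements \<open>a\<close> such that right multiplication by \<open>a\<close> is a sum of endomorphisms of the regular
  module factoring through \<open>P\<close> form the trace ideal \<open>I\<close> of \<open>P\<close>. Every map from \<open>P\<close> to the regular
  module dies in \<open>A/I\<close>; for a generator \<open>P\<close> this forces \<open>A/I = 0\<close>.
\<close>

lemma resolves_generator:
  fixes i :: "'a \<Rightarrow> 'u"
  assumes inj: "inj_on i (carrier A)" and P: "left_module A P" and gen: "cat.generator P"
  shows "\<exists>l. cat.resolves l U P"
proof -
  let ?S = "arrows cat U P \<times> arrows cat P U"
  define I where "I = {a \<in> carrier A. \<exists>l. set l \<subseteq> ?S \<and> cat.factor_sum U P l u = a \<odot>\<^bsub>U\<^esub> u}"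
  have "left_ideal I A"
  proof (rule A.left_idealI)
    show "I \<subseteq> carrier A" by (auto simp: I_def)
    show "\<zero>\<^bsub>A\<^esub> \<in> I" by (auto simp: I_def U.act_l_zero intro!: exI[of _ "[]"])
    show "a \<oplus>\<^bsub>A\<^esub> b \<in> I" if ab: "a \<in> I" "b \<in> I" for a b
    proof -
      obtain l l' where "set l \<subseteq> ?S" "cat.factor_sum U P l u = a \<odot>\<^bsub>U\<^esub> u"
        "set l' \<subseteq> ?S" "cat.factor_sum U P l' u = b \<odot>\<^bsub>U\<^esub> u"
        using ab by (auto simp: I_def)
      then show ?thesis
        using ab factor_sum_append_at_u[OF P, of l l']
        by (auto simp: I_def U.act_l_distr intro!: exI[of _ "l @ l'"])
    qed
    show "a \<otimes>\<^bsub>A\<^esub> b \<in> I" if a: "a \<in> carrier A" and b: "b \<in> I" for a b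
    proof -
      obtain l where "set l \<subseteq> ?S" "cat.factor_sum U P l u = b \<odot>\<^bsub>U\<^esub> u"
        using b by (auto simp: I_def)
      then show ?thesis
        using factor_sum_scale_at_u[OF P _ a, of l] a b by (auto simp: I_def U.act_assoc)
    qed
  qed
  then obtain W :: "('a, 'u) module" and w where W: "left_module A W" and w: "w \<in> carrier W"
    and ker: "\<And>a. a \<in> carrier A \<Longrightarrow> a \<odot>\<^bsub>W\<^esub> w = \<zero>\<^bsub>W\<^esub> \<longleftrightarrow> a \<in> I"
    using ex_cyclic_module[OF _ inj] by metis
  let ?p = "hom_from W w"
  have p: "?p \<in> arrows cat U W" by (rule hom_from_arrow[OF W w])
  have "cat.seq P U W h ?p = cat.hom_zero P W" if h: "h \<in> arrows cat P U" for h
  proof (rule extensionalityI[of _ "carrier P"])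
    fix x assume x: "x \<in> carrier P"
    have "h x \<in> carrier U" using h x by (simp add: lin_maps_closed[where R = A and V = U] lin_maps_closed[where R = A and V = P])
    then obtain b where b: "b \<in> carrier A" "h x = b \<odot>\<^bsub>U\<^esub> u" using cyclic by blast
    have g: "hom_from P x \<in> arrows cat U P" by (rule hom_from_arrow[OF P x])
    \<comment> \<open>A single pair shows that the coefficient of \<open>h x\<close> lies in the
      trace ideal: go from \<open>u\<close> to \<open>x\<close>, then apply \<open>h\<close>. Hence
      \<open>h\<close> followed by the projection kills \<open>x\<close>.\<close>
    have "cat.factor_sum U P [(hom_from P x, h)] u = b \<odot>\<^bsub>U\<^esub> u"
      using b P x unfolding factor_sum_at_u(2)[OF g] by (simp add: U.act_closed)
    moreover have "set [(hom_from P x, h)] \<subseteq> ?S" using g h by simp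
    ultimately have "b \<in> I" unfolding I_def using b(1) by blast
    then show "cat.seq P U W h ?p x = cat.hom_zero P W x"
      using x b ker by (simp add: compose_eq hom_from_act)
  qed simp_all
  then have "?p = cat.hom_zero U W"
    using gen p W unfolding cat.generator_def by (simp add: U.left_module_axioms)
  \<comment> \<open>The cyclic generator is the value of the vanishing projection at
    \<open>u\<close>; its annihilator \<open>I\<close> therefore contains one.\<close>
  then have "w = \<zero>\<^bsub>W\<^esub>" using hom_from_u[OF W w] by simp
  then have "\<one>\<^bsub>A\<^esub> \<in> I"
    using ker[of "\<one>\<^bsub>A\<^esub>"] left_module.act_one[OF W w] by simp
  then obtain l where l: "set l \<subseteq> ?S" "cat.factor_sum U P l u = u"
    by (auto simp: I_def U.act_one)
  have "cat.factor_sum U P l = id_arr cat U"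
    by (rule arrow_eqI[OF factor_sum_arrow[OF P l(1)]])
      (use cat.id_closed[of U] U.left_module_axioms l(2) in simp_all)
  then show ?thesis using l(1) by (auto simp: cat.resolves_def)
qed

end

text \<open>The cyclic module belonging to the zero left ideal.\<close>

lemma (in assoc_algebra) ex_regular_module:
  fixes i :: "'a \<Rightarrow> 'u"
  assumes "inj_on i (carrier A)"
  shows "\<exists>(U :: ('a, 'u) module) u. regular_module F A U u"
proof -
  have "left_ideal {\<zero>\<^bsub>A\<^esub>} A" by (rule A.left_idealI) simp_all
  from ex_cyclic_module[OF this assms] obtain U :: "('a, 'u) module" and u
    where "left_module A U" "u \<in> carrier U"
      "\<And>x. x \<in> carrier U \<Longrightarrow> \<exists>a\<in>carrier A. x = a \<odot>\<^bsub>U\<^esub> u"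
      "\<And>a. a \<in> carrier A \<Longrightarrow> a \<odot>\<^bsub>U\<^esub> u = \<zero>\<^bsub>U\<^esub> \<Longrightarrow> a = \<zero>\<^bsub>A\<^esub>"
    by auto
  then have "regular_module F A U u"
    by (intro regular_module.intro regular_module_axioms.intro assoc_algebra_axioms)
  then show ?thesis by blast
qed

lemma morita_equivalent_KR_equivalent:
  fixes A :: "('k, 'a, 'd) module_scheme" and B :: "('k, 'b, 'e) module_scheme"
  assumes A: "assoc_algebra F A" and B: "assoc_algebra F B"
    and "module_universe TYPE('u) A" and "module_universe TYPE('u) B"
    and morita: "morita_equivalent TYPE('u) F A B"
  shows "KR_equivalent F A B"
proof -
  let ?C = "module_category A :: ('k, ('a, 'u) module, 'u \<Rightarrow> 'u) linear_category"
  let ?D = "module_category B :: ('k, ('b, 'u) module, 'u \<Rightarrow> 'u) linear_category"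
  interpret A: assoc_algebra F A by fact
  interpret B: assoc_algebra F B by fact
  obtain i :: "'a \<Rightarrow> 'u" and j :: "'b \<Rightarrow> 'u" where i: "inj_on i (carrier A)" and j: "inj_on j (carrier B)"
    using assms(3,4) by (auto simp: module_universe_def lepoll_def)
  obtain U :: "('a, 'u) module" and u where "regular_module F A U u"
    using A.ex_regular_module[OF i] by blast
  then interpret U: regular_module F A U u .
  obtain V :: "('b, 'u) module" and v where "regular_module F B V v"
    using B.ex_regular_module[OF j] by blast
  then interpret V: regular_module F B V v .
  obtain T S where "linear_equiv F ?C ?D T S"
    using morita unfolding morita_equivalent_def linearly_equivalent_def
    by (auto intro!: linear_equiv.intro linear_equiv_axioms.intro
        U.cat.linear_cat_axioms V.cat.linear_cat_axioms)
  then interpret equiv: linear_equiv F ?C ?D T S .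
  interpret op: linear_equiv F ?D ?C S T by (rule equiv.swap)
  have U: "U \<in> objects ?C" and V: "V \<in> objects ?D"
    by (simp_all add: U.U.left_module_axioms V.U.left_module_axioms)
  \<comment> \<open>The image of the regular \<open>A\<close>-module is a generator among
    \<open>B\<close>-modules, so its trace ideal in \<open>B\<close> is everything; the next step is
    the mirror image through \<open>S\<close>.\<close>
  obtain l where l: "V.cat.resolves l V (on_objects T U)"
    using V.resolves_generator[OF j _ equiv.generator_image[OF U U.generator_regular]]
      equiv.T_object[OF U] by auto
  obtain l' where l': "U.cat.resolves l' U (on_objects S V)"
    using U.resolves_generator[OF i _ op.generator_image[OF V V.generator_regular]]
      op.T_object[OF V] by auto
  have E: "KR_equivalent F (U.cat.end_algebra U) (V.cat.end_algebra V)"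
    by (rule equiv.end_algebra_KR_equivalent[OF U V l l'])
  note EU = U.cat.end_algebra[OF U] and EV = V.cat.end_algebra[OF V]
  have "KR_equivalent F A (V.cat.end_algebra V)"
    by (rule KR_equivalent_trans[OF A EU EV U.KR_equivalent_end_algebra E])
  then show ?thesis
    by (rule KR_equivalent_trans[OF A EV B _ KR_equivalent_sym[OF V.KR_equivalent_end_algebra]])
qed

theorem theorem2p1:
  fixes F :: "'k ring" and A :: "('k, 'a) module" and B :: "('k, 'b) module"
  assumes "assoc_algebra F A" and "finite_dimensional F A"
    and "assoc_algebra F B" and "finite_dimensional F B"
    and "module_universe TYPE('u) A" and "module_universe TYPE('u) B"
    and "morita_equivalent TYPE('u) F A B"
  shows "\<exists>\<phi> \<in> lin_isos F (quotient_space A (commutator_space F A))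
                        (quotient_space B (commutator_space F B)).
           \<forall>n\<ge>1. \<exists>\<psi> \<in> lin_isos F (quotient_space A (KR F A n)) (quotient_space B (KR F B n)).
             \<forall>U \<in> carrier (quotient_space A (commutator_space F A)).
               \<psi> (canonical_epi A (KR F A n) U) = canonical_epi B (KR F B n) (\<phi> U)"
  using KR_equivalent_quotients[OF assms(1,3) morita_equivalent_KR_equivalent[OF assms(1,3,5-7)]]
  by blast

end
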